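(* Let $\mathcal{D}\subseteq\mathbb{M}$ be an MSRD code of minimum distance $d$ and assume that there exists a chain of MSRD codes $\mathcal{D}=\mathcal{D}_d\supseteq\mathcal{D}_{d+1}\supseteq\cdots\supseteq\mathcal{D}_n$ such that $d(\mathcal{D}_h)=h$ for $d\leq h\leq n$. A sequence of positive integers $d_1,\ldots,d_k$ is the sequence of generalized sum-rank weights of a code $\mathcal{C}\subseteq\mathcal{D}$ if and only if $k\leq\dim(\mathcal{D})$ and $d_1,\ldots,d_k$ is a subsequence of the sequence of generalized weights of $\mathcal{D}$. Moreover, the code $\mathcal{C}$ may always be chosen such that it satisfies the chain condition. In particular, any subsequence of the sequence of generalized sum-rank weights of $\mathcal{D}$ is the sequence of greedy weights of a subcode of $\mathcal{D}$.
   Context: Write $[r]=\{1,\ldots,r\}$. Let $q$ be a prime power and let $t,n_1,\ldots,n_t,m_1,\ldots,m_t$ be positive integers with $m_1\geq\cdots\geq m_t$ and $m_i\geq n_i$ for $i\in[t]$. Let $\mathbb{M}=\mathbb{F}_q^{m_1\times n_1}\times\cdots\times\mathbb{F}_q^{m_t\times n_t}$ and $n=n_1+\cdots+n_t$. For $C=(C_1,\ldots,C_t)\in\mathbb{M}$ let $\mathrm{srk}(C)=\sum_{i=1}^t\mathrm{rk}(C_i)$. A (sum-rank metric) code is an $\mathbb{F}_q$-linear subspace $\mathcal{C}\subseteq\mathbb{M}$; a subcode is a linear subspace of a code. The minimum distance of $\mathcal{C}\neq 0$ is $d(\mathcal{C})=\min\{\mathrm{srk}(C) : C\in\mathcal{C}\setminus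 0\}$, and $\mathrm{maxsrk}(\mathcal{C})=\max\{\mathrm{srk}(C) : C\in\mathcal{C}\}$. A linear subspace $\mathcal{A}_i\subseteq\mathbb{F}_q^{m_i\times n_i}$ is an optimal anticode (OAC) if $\dim(\mathcal{A}_i)=m_i\max\{\mathrm{rk}(A) : A\in\mathcal{A}_i\}$. The weight of a code is $\mathrm{wt}(\mathcal{C})=\min\{\mathrm{maxsrk}(\mathcal{A}) : \mathcal{C}\subseteq\mathcal{A}=\mathcal{A}_1\times\cdots\times\mathcal{A}_t,\ \mathcal{A}_i\subseteq\mathbb{F}_q^{m_i\times n_i}\text{ an OAC for all }i\in[t]\}$. For $r\in[\dim(\mathcal{C})]$, the $r$-th generalized (sum-rank) weight is $d_r(\mathcal{C})=\min\{\mathrm{wt}(\mathcal{U}) : \mathcal{U}\text{ is a subcode of }\mathcal{C},\ \dim(\mathcal{U})\geq r\}$; the sequence of generalized weights of $\mathcal{C}$ is $d_1(\mathcal{C}),\ldots,d_{\dim(\mathcal{C})}(\mathcal{C})$. A code $\mathcal{C}\subseteq\mathbb{M}$ is maximum sum-rank distance (MSRD) if there exist $j\in[t]$ and $0\leq\delta\leq n_j-1$ such that $d(\mathcal{C})=\sum_{i=1}^{j-1}n_i+\delta+1$ and $\dim(\mathcal{C})=\sum_{i=j}^t m_in_i-\delta m_j$. Chain condition: a $k$-dimensional code $\mathcal{C}\neq 0$ satisfies the chain condition if there is a chain of subcodes $0\subsetneq\mathcal{U}_1\subsetneq\cdots\subsetneq\mathcal{U}_k=\mathcal{C}$ with $\mathrm{wt}(\mathcal{U}_r)=d_r(\mathcal{C})$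 for all $r\in[k]$. Greedy weights: for a $k$-dimensional code $\mathcal{C}\neq 0$, a greedy $1$-subcode is a $1$-dimensional subcode $\mathcal{U}_1$ with $\mathrm{wt}(\mathcal{U}_1)=d_1(\mathcal{C})$; for $2\leq r\leq k$ a greedy $r$-subcode is an $r$-dimensional subcode of $\mathcal{C}$ of minimum weight among those that contain a greedy $(r-1)$-subcode. The $r$-th greedy weight is $g_r(\mathcal{C})=\mathrm{wt}(\mathcal{U}_r)$ for any greedy $r$-subcode $\mathcal{U}_r$; the sequence of greedy weights is $g_1(\mathcal{C}),\ldots,g_k(\mathcal{C})$. *)

theory Defs
  imports Jordan_Normal_Form.DL_Rank "HOL-Library.Sublist" "HOL-Library.FuncSet"
begin

text \<open>
  The field with \<open>q\<close> elements is a type \<open>'a :: {field, finite}\<close>.  Blocks are indexed by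
  \<open>{1..t}\<close>; block \<open>i\<close> consists of matrices with \<open>m i\<close> rows and \<open>n i\<close> columns.  A tuple of
  matrices is a function that is \<open>undefined\<close> outside \<open>{1..t}\<close>.
\<close>

definition sr_space ::
  "nat \<Rightarrow> (nat \<Rightarrow> nat) \<Rightarrow> (nat \<Rightarrow> nat) \<Rightarrow> ('a :: field, nat \<Rightarrow> 'a mat) module" where
  "sr_space t m n = \<lparr>
     carrier = (\<Pi>\<^sub>E i\<in>{1..t}. carrier_mat (m i) (n i)),
     mult = undefined,
     one = undefined,
     zero = (\<lambda>i\<in>{1..t}. 0\<^sub>m (m i) (n i)),
     add = (\<lambda>A B. \<lambda>i\<in>{1..t}. A i + B i),
     smult = (\<lambda>c A. \<lambda>i\<in>{1..t}. c \<cdot>\<^sub>m A i)\<rparr>"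

lemma sr_space_simps:
  "carrier (sr_space t m n) = (\<Pi>\<^sub>E i\<in>{1..t}. carrier_mat (m i) (n i))"
  "\<zero>\<^bsub>sr_space t m n\<^esub> = (\<lambda>i\<in>{1..t}. 0\<^sub>m (m i) (n i))"
  "A \<oplus>\<^bsub>sr_space t m n\<^esub> B = (\<lambda>i\<in>{1..t}. A i + B i)"
  "c \<odot>\<^bsub>sr_space t m n\<^esub> A = (\<lambda>i\<in>{1..t}. c \<cdot>\<^sub>m A i)"
  by (simp_all add: sr_space_def)

lemma vectorspace_sr_space:
  "vectorspace (class_ring :: 'a :: field ring) (sr_space t m n)"
proof -
  let ?V = "sr_space t m n :: ('a, nat \<Rightarrow> 'a mat) module"
  have mem: "A i \<in> carrier_mat (m i) (n i)" if "A \<in> carrier ?V" "i \<in> {1..t}" for A i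
    using that by (auto simp: sr_space_simps)
  have ext: "A = B"
    if "A \<in> carrier ?V" "B \<in> carrier ?V" "\<And>i. i \<in> {1..t} \<Longrightarrow> A i = B i" for A B
    using that by (intro PiE_ext[of _ "{1..t}" "\<lambda>i. carrier_mat (m i) (n i)"])
      (auto simp: sr_space_simps)
  have add_c: "A \<oplus>\<^bsub>?V\<^esub> B \<in> carrier ?V" if "A \<in> carrier ?V" "B \<in> carrier ?V" for A B
    using mem[OF that(1)] mem[OF that(2)] by (auto simp: sr_space_simps)
  have smult_c: "c \<odot>\<^bsub>?V\<^esub> A \<in> carrier ?V" if "A \<in> carrier ?V" for A c
    using mem[OF that] by (auto simp: sr_space_simps)
  have zero_c: "\<zero>\<^bsub>?V\<^esub> \<in> carrier ?V"
    by (auto simp: sr_space_simps)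
  have ab: "abelian_group ?V"
  proof (rule abelian_groupI)
    fix A assume A: "A \<in> carrier ?V"
    show "\<exists>B\<in>carrier ?V. B \<oplus>\<^bsub>?V\<^esub> A = \<zero>\<^bsub>?V\<^esub>"
    proof (rule bexI[OF _ smult_c[OF A, of "-1"]])
      show "(-1) \<odot>\<^bsub>?V\<^esub> A \<oplus>\<^bsub>?V\<^esub> A = \<zero>\<^bsub>?V\<^esub>"
      proof (rule ext[OF add_c[OF smult_c[OF A] A] zero_c])
        fix i assume i: "i \<in> {1..t}"
        show "((-1) \<odot>\<^bsub>?V\<^esub> A \<oplus>\<^bsub>?V\<^esub> A) i = \<zero>\<^bsub>?V\<^esub> i"
          using i mem[OF A i] by (auto simp: sr_space_simps intro!: eq_matI)
      qed
    qed
  next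
    fix A B C assume *: "A \<in> carrier ?V" "B \<in> carrier ?V" "C \<in> carrier ?V"
    show "A \<oplus>\<^bsub>?V\<^esub> B \<oplus>\<^bsub>?V\<^esub> C = A \<oplus>\<^bsub>?V\<^esub> (B \<oplus>\<^bsub>?V\<^esub> C)"
      by (auto simp: sr_space_simps
          intro!: restrict_ext assoc_add_mat[OF mem[OF *(1)] mem[OF *(2)] mem[OF *(3)]])
  next
    fix A B assume *: "A \<in> carrier ?V" "B \<in> carrier ?V"
    show "A \<oplus>\<^bsub>?V\<^esub> B = B \<oplus>\<^bsub>?V\<^esub> A"
      by (auto simp: sr_space_simps intro!: restrict_ext comm_add_mat[OF mem[OF *(1)] mem[OF *(2)]])
  next
    fix A assume A: "A \<in> carrier ?V"
    show "\<zero>\<^bsub>?V\<^esub> \<oplus>\<^bsub>?V\<^esub> A = A"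
      by (rule ext[OF add_c[OF zero_c A] A]) (use mem[OF A] in \<open>auto simp: sr_space_simps\<close>)
  qed (use add_c zero_c in auto)
  have "Module.module (class_ring :: 'a ring) ?V"
  proof (rule Module.module.intro[OF _ ab])
    show "cring (class_ring :: 'a ring)"
      using class_field field_def domain_def by blast
    show "Module.module_axioms (class_ring :: 'a ring) ?V"
    proof (unfold_locales, goal_cases)
      case (1 c A)
      show ?case by (rule smult_c[OF 1(2)])
    next
      case (2 c d A)
      then show ?case using mem[OF 2(3)]
        by (auto simp: sr_space_simps class_ring_simps
            intro!: restrict_ext add_smult_distrib_right_mat[OF mem[OF 2(3)]])
    next
      case (3 c A B)
      then show ?case using mem[OF 3(2)] mem[OF 3(3)]
        by (auto simp: sr_space_simps class_ring_simps
            intro!: restrict_ext add_smult_distrib_left_mat[OF mem[OF 3(2)] mem[OF 3(3)]])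
    next
      case (4 c d A)
      then show ?case using mem[OF 4(3)]
        by (auto simp: sr_space_simps class_ring_simps intro!: restrict_ext)
    next
      case (5 A)
      show ?case
        by (rule ext) (use 5 mem[OF 5] smult_c[OF 5] in
          \<open>auto simp: sr_space_simps class_ring_simps intro!: eq_matI\<close>)
    qed
  qed
  then show ?thesis
    by (simp add: vectorspace_def class_field)
qed

abbreviation sr_code where
  "sr_code t m n C \<equiv> subspace class_ring C (sr_space t m n)"

definition code_dim where
  "code_dim t m n C = vectorspace.dim class_ring (sr_space t m n\<lparr>carrier := C\<rparr>)"

definition srk :: "nat \<Rightarrow> (nat \<Rightarrow> nat) \<Rightarrow> (nat \<Rightarrow> 'a :: field mat) \<Rightarrow> nat" where
  "srk t m C = (\<Sum>i=1..t. vec_space.rank (m i) (C i))"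

definition min_dist where
  "min_dist t m n C = Min (srk t m ` (C - {\<zero>\<^bsub>sr_space t m n\<^esub>}))"

definition maxsrk where
  "maxsrk t m C = Max (srk t m ` C)"

definition optimal_anticode :: "nat \<Rightarrow> nat \<Rightarrow> 'a :: field mat set \<Rightarrow> bool" where
  "optimal_anticode k l A \<longleftrightarrow>
     subspace class_ring A (module_mat TYPE('a) k l) \<and>
     vectorspace.dim class_ring (module_mat TYPE('a) k l\<lparr>carrier := A\<rparr>)
       = k * Max (vec_space.rank k ` A)"

definition code_wt ::
  "nat \<Rightarrow> (nat \<Rightarrow> nat) \<Rightarrow> (nat \<Rightarrow> nat) \<Rightarrow> (nat \<Rightarrow> 'a :: field mat) set \<Rightarrow> nat" where
  "code_wt t m n C = Min {maxsrk t m (Pi\<^sub>E {1..t} A) | A.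
     (\<forall>i\<in>{1..t}. optimal_anticode (m i) (n i) (A i)) \<and> C \<subseteq> Pi\<^sub>E {1..t} A}"

definition gen_wt where
  "gen_wt t m n C r = Min {code_wt t m n U | U.
     sr_code t m n U \<and> U \<subseteq> C \<and> code_dim t m n U \<ge> r}"

definition gen_wts where
  "gen_wts t m n C = map (gen_wt t m n C) [1..<code_dim t m n C + 1]"

text \<open>The subtraction below does not truncate, since \<open>\<delta> < n j\<close>.\<close>

definition MSRD where
  "MSRD t m n C \<longleftrightarrow> sr_code t m n C \<and>
     (\<exists>j\<in>{1..t}. \<exists>\<delta><n j.
        min_dist t m n C = (\<Sum>i=1..<j. n i) + \<delta> + 1 \<and>
        code_dim t m n C = (\<Sum>i=j..t. m i * n i) - \<delta> * m j)"

definition chain_condition where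
  "chain_condition t m n C \<longleftrightarrow>
     sr_code t m n C \<and> C \<noteq> {\<zero>\<^bsub>sr_space t m n\<^esub>} \<and>
     (\<exists>U. (\<forall>r\<in>{1..code_dim t m n C}.
              sr_code t m n (U r) \<and> code_wt t m n (U r) = gen_wt t m n C r) \<and>
          {\<zero>\<^bsub>sr_space t m n\<^esub>} \<subset> U 1 \<and>
          (\<forall>r\<in>{1..<code_dim t m n C}. U r \<subset> U (Suc r)) \<and>
          U (code_dim t m n C) = C)"

text \<open>There are no greedy \<open>0\<close>-subcodes; the recursion starts at \<open>1\<close>.\<close>

fun greedy_subcode ::
  "nat \<Rightarrow> (nat \<Rightarrow> nat) \<Rightarrow> (nat \<Rightarrow> nat) \<Rightarrow> (nat \<Rightarrow> 'a :: field mat) set \<Rightarrow> nat \<Rightarrow>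
   (nat \<Rightarrow> 'a mat) set \<Rightarrow> bool" where
  "greedy_subcode t m n C 0 U \<longleftrightarrow> False"
| "greedy_subcode t m n C (Suc 0) U \<longleftrightarrow>
     sr_code t m n U \<and> U \<subseteq> C \<and> code_dim t m n U = 1 \<and> code_wt t m n U = gen_wt t m n C 1"
| "greedy_subcode t m n C (Suc (Suc r)) U \<longleftrightarrow>
     sr_code t m n U \<and> U \<subseteq> C \<and> code_dim t m n U = Suc (Suc r) \<and>
     (\<exists>W. greedy_subcode t m n C (Suc r) W \<and> W \<subseteq> U) \<and>
     (\<forall>V. sr_code t m n V \<and> V \<subseteq> C \<and> code_dim t m n V = Suc (Suc r) \<and>
          (\<exists>W. greedy_subcode t m n C (Suc r) W \<and> W \<subseteq> V) \<longrightarrow>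
          code_wt t m n U \<le> code_wt t m n V)"

definition greedy_wt where
  "greedy_wt t m n C r = (THE w. \<exists>U. greedy_subcode t m n C r U \<and> w = code_wt t m n U)"

definition greedy_wts where
  "greedy_wts t m n C = map (greedy_wt t m n C) [1..<code_dim t m n C + 1]"

end

theory Submission
  imports Defs "HOL-Library.Function_Algebras" "HOL-Library.Product_Plus"
    "HOL-Library.Cardinality"
begin

text \<open>
  Number the columns of all blocks consecutively and let \<open>mu p\<close> be the height of column \<open>p\<close>.
  Every optimal anticode of maximal rank \<open>u > 0\<close> contains one of maximal rank \<open>u - 1\<close>.  Hence a
  subcode \<open>U\<close> of weight \<open>p\<close> contains one of smaller weight whose codimension in \<open>U\<close> is at most
  \<open>mu p\<close>, so no code has more than \<open>mu p\<close> generalized weights equal to \<open>p\<close>.  An MSRD code of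
  minimum distance \<open>d\<close> has dimension \<open>mu d + \<dots> + mu n\<close> and all its weights lie between \<open>d\<close> and
  \<open>n\<close>, so it attains all these bounds; this settles the "only if" part.

  Conversely, let \<open>A p\<close> be the space of tuples supported on the first \<open>p\<close> columns.  Then
  \<open>D p \<inter> A p\<close> has dimension at least \<open>mu p\<close> and \<open>D p \<inter> A (p - 1) = 0\<close>, so one can pick independent
  \<open>x r \<in> D (d r) \<inter> A (d r)\<close>.  The span of \<open>x 1, \<dots>, x r\<close> lies in \<open>A (d r)\<close>, and every
  \<open>r\<close>-dimensional subcode of the span of all \<open>x i\<close> meets the span of \<open>x r, x (r + 1), \<dots>\<close>, which
  lies in \<open>D (d r)\<close>.  The chain of these spans then also consists of greedy subcodes.

  Over a finite field, dimensions are handled as cardinalities.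
\<close>

section \<open>Affine spaces of matrices of bounded rank\<close>

text \<open>The difficult claim is that optimal anticodes contain smaller ones. Forcing a column to
  vanish costs at most \<open>m\<close> dimensions but need not lower the rank: the square matrices
  whose columns lie in a fixed space of dimension \<open>u < m\<close> form an optimal anticode, and
  there a row has to be killed instead. To separate the two situations one counts the rank one
  matrices with column direction \<open>w\<close> in the anticode. Once one column is fixed to be
  \<open>w\<close>, nonzero, the others range over an affine space whose rank modulo
  \<open>w\<close> is at most \<open>u - 1\<close>. The bound \<open>dim \<le> m * rank\<close> is
  therefore proved for translates \<open>Z + S\<close> and modulo a subspace \<open>N\<close>, by an
  argument that also works over the field with two elements. The shape of the anticode is then
  forced by equality in such counts.\<close>

lemma card_le_fibers:
  assumes "finite G" "finite H" "f ` G \<subseteq> H" "\<And>y. y \<in> H \<Longrightarrow> card {x \<in> G. f x = y} \<le> c"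
  shows "card G \<le> card H * c"
proof -
  have "G = (\<Union>y\<in>H. {x \<in> G. f x = y})" using assms(3) by auto
  then have "card G \<le> (\<Sum>y\<in>H. card {x \<in> G. f x = y})"
    using card_UN_le[OF assms(2), of "\<lambda>y. {x \<in> G. f x = y}"] by simp
  also have "\<dots> \<le> card H * c" using sum_bounded_above[of H, OF assms(4)] by simp
  finally show ?thesis .
qed

lemma card_hom_image_kernel:
  fixes f :: "'c::ab_group_add \<Rightarrow> 'd::ab_group_add"
  assumes fin: "finite G" and diff: "\<And>x y. x \<in> G \<Longrightarrow> y \<in> G \<Longrightarrow> x - y \<in> G"
    and f: "\<And>x y. x \<in> G \<Longrightarrow> y \<in> G \<Longrightarrow> f (x - y) = f x - f y"
  shows "card G = card (f ` G) * card {x \<in> G. f x = 0}"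
proof -
  have add: "x + y \<in> G" if "x \<in> G" "y \<in> G" for x y
    using diff[OF that(1) diff[OF diff[OF that(2) that(2)] that(2)]] by simp
  have "card {x \<in> G. f x = y} = card {x \<in> G. f x = 0}" if y: "y \<in> f ` G" for y
  proof -
    obtain x0 where x0: "x0 \<in> G" "f x0 = y" using y by auto
    have "f (x + x0) = f x0" if "x \<in> G" "f x = 0" for x
      using f[OF add[OF that(1) x0(1)] x0(1)] that by simp
    then have "bij_betw (\<lambda>x. x - x0) {x \<in> G. f x = y} {x \<in> G. f x = 0}"
      using x0 diff add f by (intro bij_betw_byWitness[where f' = "\<lambda>x. x + x0"]) auto
    then show ?thesis by (rule bij_betw_same_card)
  qed
  then have "(\<Sum>y\<in>f ` G. card {x \<in> G. f x = y}) = card (f ` G) * card {x \<in> G. f x = 0}"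
    by simp
  moreover have "card G = (\<Sum>y\<in>f ` G. card {x \<in> G. f x = y})"
    using sum.image_gen[OF fin, of "\<lambda>_. 1::nat" f] by simp
  ultimately show ?thesis by simp
qed

lemma CARD_field_gt_1: "1 < CARD('a::{field,finite})"
proof -
  have "card {0, 1::'a} \<le> CARD('a)" by (rule card_mono) auto
  then show ?thesis by simp
qed

section \<open>Cardinalities of spans over a finite field\<close>

locale finite_scalars = vector_space scale
  for scale :: "'a::{field,finite} \<Rightarrow> 'b::ab_group_add \<Rightarrow> 'b" (infixr "*s" 75)
begin

lemma span_insert_eq_image:
  "span (insert v S) = (\<lambda>(k, u). u + k *s v) ` (UNIV \<times> span S)"
proof -
  have "x \<in> (\<lambda>(k, u). u + k *s v) ` (UNIV \<times> span S)" if "x - k *s v \<in> span S" for x k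
    using that by (intro image_eqI[of _ _ "(k, x - k *s v)"]) auto
  moreover have "\<exists>k'. u + k *s v - k' *s v \<in> span S" if "u \<in> span S" for k u
    using that by (intro exI[of _ k]) simp
  ultimately show ?thesis unfolding span_insert by auto
qed

lemma span_insert_add:
  assumes "x \<in> span R"
  shows "span (insert (c + x) R) = span (insert c R)"
proof -
  have *: "span (insert (c + x) R) \<subseteq> span (insert c R)" if "x \<in> span R" for c x
  proof (rule span_minimal[OF _ subspace_span], rule insert_subsetI)
    show "c + x \<in> span (insert c R)"
      using that span_mono[of R "insert c R"] by (intro span_add) (auto intro: span_base)
    show "R \<subseteq> span (insert c R)" using span_superset[of "insert c R"] by auto
  qed
  show ?thesis using *[OF assms, of c] *[OF span_neg[OF assms], of "c + x"] by auto
qed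

lemma finite_span: "finite S \<Longrightarrow> finite (span S)"
  by (induction S rule: finite_induct) (auto simp: span_insert_eq_image)

lemma card_span_insert_le:
  assumes "finite (span S)"
  shows "card (span (insert v S)) \<le> CARD('a) * card (span S)"
proof -
  have "card (span (insert v S)) \<le> card ((UNIV :: 'a set) \<times> span S)"
    unfolding span_insert_eq_image using assms by (intro card_image_le) auto
  then show ?thesis by (simp add: card_cartesian_product)
qed

lemma card_span_insert:
  assumes "finite (span S)" "v \<notin> span S"
  shows "card (span (insert v S)) = CARD('a) * card (span S)"
proof -
  have "inj_on (\<lambda>(k, u). u + k *s v) ((UNIV :: 'a set) \<times> span S)"
  proof (rule inj_onI, clarify)
    fix k u k' u' assume u: "u \<in> span S" "u' \<in> span S" and eq: "u + k *s v = u' + k' *s v"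
    have k: "(k - k') *s v = u' - u" using eq by (simp add: algebra_simps)
    have "k = k'"
    proof (rule ccontr)
      assume "k \<noteq> k'"
      then have "v = inverse (k - k') *s (u' - u)" by (simp add: k[symmetric])
      then show False using span_scale[OF span_diff[OF u(2,1)]] assms(2) by simp
    qed
    then show "k = k' \<and> u = u'" using eq by simp
  qed
  then show ?thesis
    unfolding span_insert_eq_image by (subst card_image) (auto simp: card_cartesian_product)
qed

lemma card_span_pos: "finite (span S) \<Longrightarrow> card (span S) > 0"
  using span_zero[of S] card_gt_0_iff by blast

lemma card_span_le: "finite S \<Longrightarrow> card (span S) \<le> CARD('a) ^ card S"
proof (induction S rule: finite_induct)
  case (insert v S)
  then show ?case
    using order_trans[OF card_span_insert_le[OF finite_span[OF insert(1)]]]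
    by (simp add: mult_left_mono)
qed simp

lemma card_span_independent: "finite S \<Longrightarrow> independent S \<Longrightarrow> card (span S) = CARD('a) ^ card S"
proof (induction S rule: finite_induct)
  case (insert v S)
  then have "v \<notin> span S" "independent S" using independent_insert[of v S] by auto
  then show ?case using card_span_insert[OF finite_span[OF insert(1)]] insert by simp
qed simp

lemma card_span_Un_le:
  assumes "finite (span S)" "finite K"
  shows "card (span (S \<union> K)) \<le> CARD('a) ^ card K * card (span S) \<and> finite (span (S \<union> K))"
  using assms(2)
proof (induction K rule: finite_induct)
  case (insert v K)
  have "card (span (insert v (S \<union> K))) \<le> CARD('a) * card (span (S \<union> K))"
    using insert by (intro card_span_insert_le) auto
  also have "\<dots> \<le> CARD('a) * (CARD('a) ^ card K * card (span S))"
    using insert by (intro mult_left_mono) auto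
  finally show ?case using insert by (auto simp: span_insert_eq_image)
qed (use assms in auto)

lemma finite_subspace_basis:
  assumes "finite W" "subspace W"
  obtains B where "B \<subseteq> W" "finite B" "independent B" "span B = W" "card W = CARD('a) ^ card B"
proof -
  obtain B where B: "B \<subseteq> W" "independent B" "W \<subseteq> span B"
    using maximal_independent_subset by metis
  have "span B = W" using B assms span_minimal by blast
  moreover have "finite B" using B assms finite_subset by auto
  ultimately show ?thesis using that B card_span_independent by metis
qed

text \<open>A pigeonhole argument, with q the size of the field. If every \<open>T j\<close> had at
  most \<open>card N\<close> times q^r elements, the product would be too small. Setting aside a
  larger \<open>T j\<close> divides the product by at most \<open>card N\<close> times q^M, which is
  exactly one unit of \<open>r\<close>. The remaining sets then give \<open>r\<close>
  representatives by induction, and their span together with \<open>N\<close> is too small to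
  contain the set that was put aside.\<close>

lemma ex_independent_representatives:
  assumes "finite J" "card J \<le> M" "subspace N" "finite N"
    and T: "\<And>j. j \<in> J \<Longrightarrow> finite (T j)" "\<And>j. j \<in> J \<Longrightarrow> card (T j) \<le> card N * CARD('a) ^ M"
    and prod: "card N ^ card J * CARD('a) ^ (M * r) < (\<Prod>j\<in>J. card (T j))"
  shows "\<exists>K w. K \<subseteq> J \<and> card K = Suc r \<and> (\<forall>k\<in>K. w k \<in> T k) \<and>
           card (span (N \<union> w ` K)) = CARD('a) ^ Suc r * card N"
proof -
  have *: "\<exists>j\<in>J. card N * CARD('a) ^ r < card (T j)"
    if J: "finite J" "card J \<le> M"
      and prod: "card N ^ card J * CARD('a) ^ (M * r) < (\<Prod>j\<in>J. card (T j))" for J r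
  proof (rule ccontr)
    assume "\<not> ?thesis"
    then have "(\<Prod>j\<in>J. card (T j)) \<le> (\<Prod>j\<in>J. card N * CARD('a) ^ r)"
      by (intro prod_mono) auto
    also have "\<dots> = card N ^ card J * CARD('a) ^ (card J * r)"
      by (simp add: power_mult_distrib power_mult mult.commute[of _ r])
    also have "\<dots> \<le> card N ^ card J * CARD('a) ^ (M * r)"
      using J(2) by (intro mult_left_mono power_increasing mult_right_mono) (auto simp: Suc_leI)
    finally show False using prod by simp
  qed
  show ?thesis
    using assms(1,2) T prod
  proof (induction r arbitrary: J)
    case (0 J)
    obtain j where j: "j \<in> J" "card N < card (T j)" using *[OF 0(1,2,5)] by auto
    then obtain v where v: "v \<in> T j" "v \<notin> N"
      using card_mono[OF assms(4)] by (metis not_le subsetI)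
    have "card (span (insert v N)) = CARD('a) * card N"
      using card_span_insert[of N v] assms(3,4) v(2) by (simp add: span_eq_iff[THEN iffD2])
    then show ?case using j v by (intro exI[of _ "{j}"] exI[of _ "\<lambda>_. v"]) auto
  next
    case (Suc r J)
    \<comment> \<open>The large set is chosen first, but its representative last, when the span to
      be avoided is known.\<close>
    obtain j where j: "j \<in> J" "card N * CARD('a) ^ Suc r < card (T j)" using *[OF Suc(2,3,6)] by auto
    have J: "card J = Suc (card (J - {j}))" using Suc(2) j(1) by (simp only: card.remove)
    have "(card N * CARD('a) ^ M) * (card N ^ card (J - {j}) * CARD('a) ^ (M * r))
        = card N ^ card J * CARD('a) ^ (M * Suc r)"
      unfolding J by (simp add: power_add)
    also have "\<dots> < card (T j) * (\<Prod>i\<in>J - {j}. card (T i))"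
      using Suc(6) Suc(2) j(1) by (simp add: prod.remove)
    also have "\<dots> \<le> (card N * CARD('a) ^ M) * (\<Prod>i\<in>J - {j}. card (T i))"
      using Suc(5)[OF j(1)] by (intro mult_right_mono) auto
    finally have "card N ^ card (J - {j}) * CARD('a) ^ (M * r) < (\<Prod>i\<in>J - {j}. card (T i))"
      by simp
    then obtain K w where K: "K \<subseteq> J - {j}" "card K = Suc r" "\<forall>k\<in>K. w k \<in> T k"
      "card (span (N \<union> w ` K)) = CARD('a) ^ Suc r * card N"
      using Suc.IH[of "J - {j}"] Suc.prems J by auto
    have fK: "finite K" using K(2) card.infinite by fastforce
    have fin: "finite (span (N \<union> w ` K))" using assms(4) fK by (intro finite_span) auto
    then obtain v where v: "v \<in> T j" "v \<notin> span (N \<union> w ` K)"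
      using card_mono[OF fin, of "T j"] j(2) K(4) by (metis not_le subsetI mult.commute)
    have w: "(w(j := v)) ` insert j K = insert v (w ` K)" using K(1) by auto
    have "card (span (N \<union> (w(j := v)) ` insert j K)) = CARD('a) ^ Suc (Suc r) * card N"
      unfolding w using card_span_insert[OF fin v(2)] K(4) by simp
    moreover have "card (insert j K) = Suc (Suc r)" using K(1,2) fK by (subst card_insert_disjoint) auto
    moreover have "\<forall>k\<in>insert j K. (w(j := v)) k \<in> T k" using K v by auto
    ultimately show ?case using K(1) j(1) by (intro exI[of _ "insert j K"] exI[of _ "w(j := v)"]) auto
  qed
qed

text \<open>The family \<open>B\<close> is triangular modulo \<open>N\<close>: adding
  \<open>B k\<close> does not disturb the columns of \<open>J\<close> before \<open>k\<close>. So
  the pivot columns can be settled in increasing order, and for each of them it is enough to choose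
  between adding \<open>0\<close> and adding \<open>B k\<close>. The two choices differ by
  \<open>B k k\<close> in column \<open>k\<close>, so they cannot both fall into a span that misses
  \<open>B k k\<close>. No scalar other than 0 and 1 occurs, hence the field may be as small as it
  likes and \<open>Z\<close> is arbitrary.\<close>

lemma ex_independent_columns:
  fixes J K :: "nat set" and B :: "nat \<Rightarrow> nat \<Rightarrow> 'b"
  assumes "finite K" "K \<subseteq> J" "subspace N" "finite H" "N \<subseteq> span H"
    and S: "(\<lambda>_. 0) \<in> S" "\<And>X Y. X \<in> S \<Longrightarrow> Y \<in> S \<Longrightarrow> X + Y \<in> S"
    and B: "\<And>k. k \<in> K \<Longrightarrow> B k \<in> S" "\<And>i k. k \<in> K \<Longrightarrow> i \<in> J \<Longrightarrow> i < k \<Longrightarrow> B k i \<in> N"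
    and card: "card (span (H \<union> (\<lambda>k. B k k) ` K)) = CARD('a) ^ card K * card (span H)"
  shows "\<exists>X\<in>S. (\<forall>i\<in>J. (\<forall>k\<in>K. i < k) \<longrightarrow> X i \<in> N) \<and>
           card (span (H \<union> (\<lambda>k. Z k + X k) ` K)) = CARD('a) ^ card K * card (span H)"
  using assms(1,2,4,5) B card
proof (induction K arbitrary: H Z rule: finite_linorder_min_induct)
  case empty
  then show ?case using S(1) subspace_0[OF assms(3)] by auto
next
  case (insert k K)
  let ?H = "H \<union> (\<lambda>k. B k k) ` K"
  have fin: "finite (span H)" "finite (span ?H)" using insert.hyps(1) insert.prems(2) by (auto intro!: finite_span)
  have le: "card (span ?H) \<le> CARD('a) ^ card K * card (span H)"
  proof -
    have "card (span ?H) \<le> CARD('a) ^ card ((\<lambda>k. B k k) ` K) * card (span H)"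
      using card_span_Un_le[OF fin(1)] insert.hyps(1) by blast
    also have "\<dots> \<le> CARD('a) ^ card K * card (span H)"
      using card_image_le[OF insert.hyps(1)] CARD_field_gt_1[where 'a='a]
      by (intro mult_right_mono power_increasing) auto
    finally show ?thesis .
  qed
  have ins: "card (span (insert (B k k) ?H)) = CARD('a) * (CARD('a) ^ card K * card (span H))"
    using insert.prems(6) insert.hyps by (auto simp: insert_commute)
  then have card': "card (span ?H) = CARD('a) ^ card K * card (span H)"
    using card_span_insert_le[OF fin(2), of "B k k"] le by auto
  have notin: "B k k \<notin> span ?H"
  proof
    assume "B k k \<in> span ?H"
    then have "card (span (insert (B k k) ?H)) = card (span ?H)" by (simp add: span_redundant)
    then show False using ins card' CARD_field_gt_1[where 'a='a] card_span_pos[OF fin(1)] by simp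
  qed
  \<comment> \<open>The new column has to avoid the later pivots too, so that these stay independent
    once the column is adjoined to \<open>H\<close>.\<close>
  obtain Y where Y: "Y \<in> S" "\<forall>i\<in>J. i < k \<longrightarrow> Y i \<in> N" "Z k + Y k \<notin> span ?H"
  proof (cases "Z k \<in> span ?H")
    case True
    then have "Z k + B k k \<notin> span ?H" using notin span_diff[of "Z k + B k k" ?H "Z k"] by auto
    then show ?thesis using that[of "B k"] insert.prems(4,5) by auto
  next
    case False
    then show ?thesis using that[of "\<lambda>_. 0"] S(1) subspace_0[OF assms(3)] by auto
  qed
  define c where "c = Z k + Y k"
  have c: "c \<notin> span ?H" using Y(3) by (simp add: c_def)
  have "c \<notin> span H" using c span_mono[of H ?H] by auto
  then have cH: "card (span (insert c H)) = CARD('a) * card (span H)"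
    using card_span_insert fin(1) by auto
  have "card (span (insert c H \<union> (\<lambda>k. B k k) ` K)) = CARD('a) ^ card K * card (span (insert c H))"
    using card_span_insert[OF fin(2) c] by (simp add: card' cH)
  moreover have "N \<subseteq> span (insert c H)" using insert.prems(3) span_mono[of H "insert c H"] by auto
  ultimately obtain X where X: "X \<in> S" "\<forall>i\<in>J. (\<forall>k\<in>K. i < k) \<longrightarrow> X i \<in> N"
    "card (span (insert c H \<union> (\<lambda>k. (Z + Y) k + X k) ` K)) = CARD('a) ^ card K * card (span (insert c H))"
    using insert.IH[of "insert c H" "Z + Y"] insert.prems by auto
  \<comment> \<open>All later corrections change column \<open>k\<close> only by an element of
    \<open>N\<close>, which lies in the span of \<open>H\<close>; the choice made for this column
    survives.\<close>
  have Xk: "X k \<in> N" using X(2) insert.hyps(2) insert.prems(1) by auto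
  let ?R = "H \<union> (\<lambda>k. (Z + Y) k + X k) ` K"
  have XkR: "X k \<in> span ?R" using Xk insert.prems(3) span_mono[of H ?R] by auto
  have "span (insert (c + X k) ?R) = span (insert c ?R)"
    using XkR by (rule span_insert_add)
  moreover have "H \<union> (\<lambda>j. Z j + (Y + X) j) ` insert k K = insert (c + X k) ?R"
    by (auto simp: c_def algebra_simps)
  ultimately have "card (span (H \<union> (\<lambda>j. Z j + (Y + X) j) ` insert k K))
      = CARD('a) ^ card (insert k K) * card (span H)"
    using X(3) cH insert.hyps by (auto simp: mult.assoc)
  moreover have "\<forall>i\<in>J. (\<forall>j\<in>insert k K. i < j) \<longrightarrow> (Y + X) i \<in> N"
    using X(2) Y(2) subspace_add[OF assms(3)] by auto
  ultimately show ?case using S(2)[OF Y(1) X(1)] by blast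
qed

text \<open>A flag of columns, read modulo \<open>N\<close>, splits the size of \<open>S\<close> into a product over the columns.\<close>

lemma card_flag:
  fixes S :: "(nat \<Rightarrow> 'b) set" and N :: "'b set"
  defines "T J j \<equiv> (\<lambda>(X, v). X j + v) ` ({X \<in> S. \<forall>i\<in>J. i < j \<longrightarrow> X i \<in> N} \<times> N)"
  assumes "finite J" "finite S" "finite N" "subspace N"
    and S: "\<And>X Y. X \<in> S \<Longrightarrow> Y \<in> S \<Longrightarrow> X - Y \<in> S"
  shows "card S * card N ^ card J = card {X \<in> S. \<forall>i\<in>J. X i \<in> N} * (\<Prod>j\<in>J. card (T J j))"
  using assms(2)
proof (induction J rule: finite_linorder_max_induct)
  case empty
  then show ?case by simp
next
  case (insert j J)
  let ?S = "{X \<in> S. \<forall>i\<in>J. X i \<in> N}"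
  \<comment> \<open>The summand \<open>v\<close> makes this a homomorphism onto the set
    \<open>T\<close> of column \<open>j\<close>. In its kernel \<open>v\<close> is determined by
    \<open>X\<close>, so the kernel is a copy of the tuples that have column \<open>j\<close> in
    \<open>N\<close> as well.\<close>
  have "card (?S \<times> N) = card ((\<lambda>(X, v). X j + v) ` (?S \<times> N))
      * card {x \<in> ?S \<times> N. (\<lambda>(X, v). X j + v) x = 0}"
    using assms(3,4) S subspace_diff[OF assms(5)]
    by (intro card_hom_image_kernel) auto
  moreover have neg: "x \<in> N \<longleftrightarrow> - x \<in> N" for x
    using subspace_neg[OF assms(5), of x] subspace_neg[OF assms(5), of "- x"] by auto
  moreover have "bij_betw fst {x \<in> ?S \<times> N. (\<lambda>(X, v). X j + v) x = 0} {X \<in> S. \<forall>i\<in>insert j J. X i \<in> N}"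
    using neg by (intro bij_betw_byWitness[where f' = "\<lambda>X. (X, - X j)"]) (auto simp: add_eq_0_iff)
  moreover have "(\<lambda>(X, v). X j + v) ` (?S \<times> N) = T (insert j J) j"
    unfolding T_def using insert.hyps(2) by (intro arg_cong2[where f = image] refl) auto
  ultimately have step: "card ?S * card N = card (T (insert j J) j) * card {X \<in> S. \<forall>i\<in>insert j J. X i \<in> N}"
    by (simp add: card_cartesian_product bij_betw_same_card)
  have T: "T (insert j J) i = T J i" if "i \<in> J" for i
    unfolding T_def using insert.hyps(2) that by (intro arg_cong2[where f = image] refl) fastforce
  have nj: "j \<notin> J" using insert.hyps(2) by auto
  have "card S * card N ^ card (insert j J) = (card ?S * card N) * (\<Prod>i\<in>J. card (T J i))"
    using insert.IH insert.hyps(1) nj by simp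
  also have "\<dots> = card {X \<in> S. \<forall>i\<in>insert j J. X i \<in> N} * (\<Prod>i\<in>insert j J. card (T (insert j J) i))"
    unfolding step using insert.hyps(1) nj by (simp add: T)
  finally show ?case .
qed

text \<open>A Flanders type bound for the affine space \<open>Z + S\<close>, with ranks taken modulo
  \<open>N\<close>. If it failed, the factors in \<open>card_flag\<close> would be so large that
  \<open>r + 1\<close> of the columns contain representatives independent modulo \<open>N\<close>.
  These are the pivots of a triangular family in \<open>S\<close>, which combines into a single
  \<open>Z + X\<close> of rank above \<open>r\<close>. The space \<open>U\<close> bounds each factor
  by \<open>card N\<close> times q^M.\<close>

lemma anticode_bound:
  fixes S :: "(nat \<Rightarrow> 'b) set"
  assumes "finite J" "card J \<le> M" "finite S" "finite N" "subspace N"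
    and S: "\<And>X Y. X \<in> S \<Longrightarrow> Y \<in> S \<Longrightarrow> X - Y \<in> S" "S \<noteq> {}"
    and U: "finite U" "card U \<le> card N * CARD('a) ^ M" "subspace U" "N \<subseteq> U"
      "\<And>X j. X \<in> S \<Longrightarrow> j \<in> J \<Longrightarrow> X j \<in> U"
    and rank: "\<And>X. X \<in> S \<Longrightarrow> card (span (N \<union> (Z + X) ` J)) \<le> CARD('a) ^ r * card N"
  shows "card S \<le> card {X \<in> S. \<forall>j\<in>J. X j \<in> N} * CARD('a) ^ (M * r)"
proof (rule ccontr)
  assume less: "\<not> ?thesis"
  define S' where "S' = (\<lambda>j. {X \<in> S. \<forall>i\<in>J. i < j \<longrightarrow> X i \<in> N})"
  define T where "T = (\<lambda>j. (\<lambda>(X, v). X j + v) ` (S' j \<times> N))"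
  have S0: "(\<lambda>_. 0) \<in> S" proof -
    obtain X where "X \<in> S" using S(2) by auto
    then show ?thesis using S(1)[of X X] by (simp add: zero_fun_def)
  qed
  have S_add: "X + Y \<in> S" if "X \<in> S" "Y \<in> S" for X Y
    using S(1)[OF that(1) S(1)[OF S0 that(2)]] by (simp add: fun_eq_iff plus_fun_def fun_diff_def)
  have N0: "0 \<in> N" using subspace_0[OF assms(5)] .
  have cN: "card N > 0" using N0 assms(4) card_gt_0_iff by blast
  let ?k = "card {X \<in> S. \<forall>j\<in>J. X j \<in> N}"
  have "(\<lambda>_. 0) \<in> {X \<in> S. \<forall>j\<in>J. X j \<in> N}" using S0 N0 by auto
  then have kpos: "?k > 0" using assms(3) by (auto simp: card_gt_0_iff)
  have "?k * (card N ^ card J * CARD('a) ^ (M * r)) < card S * card N ^ card J"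
    using less cN by (simp add: not_le mult.assoc[symmetric] mult.commute mult.left_commute)
  also have "\<dots> = ?k * (\<Prod>j\<in>J. card (T j))"
    unfolding T_def S'_def using assms(1,3,4,5) S(1) by (rule card_flag)
  finally have "card N ^ card J * CARD('a) ^ (M * r) < (\<Prod>j\<in>J. card (T j))"
    using kpos by simp
  moreover have finT: "finite (T j)" for j using assms(3,4) by (auto simp: T_def S'_def)
  moreover have "card (T j) \<le> card N * CARD('a) ^ M" if "j \<in> J" for j
  proof -
    have "T j \<subseteq> U" using U(4,5) that subspace_add[OF U(3)] by (auto simp: T_def S'_def)
    then show ?thesis using card_mono[OF U(1)] U(2) le_trans by blast
  qed
  ultimately obtain K w where K: "K \<subseteq> J" "card K = Suc r" "\<forall>k\<in>K. w k \<in> T k"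
    "card (span (N \<union> w ` K)) = CARD('a) ^ Suc r * card N"
    using ex_independent_representatives[OF assms(1,2,5,4), of T r] by auto
  have "\<forall>k\<in>K. \<exists>X\<in>S' k. \<exists>v\<in>N. w k = X k + v" using K(3) unfolding T_def by fastforce
  then obtain B v where B: "\<And>k. k \<in> K \<Longrightarrow> B k \<in> S' k" "\<And>k. k \<in> K \<Longrightarrow> v k \<in> N"
    "\<And>k. k \<in> K \<Longrightarrow> w k = B k k + v k" by metis
  have "span (N \<union> (\<lambda>k. B k k) ` K) = span (N \<union> w ` K)"
  proof (rule span_eq[THEN iffD2], intro conjI subsetI)
    fix x assume "x \<in> N \<union> (\<lambda>k. B k k) ` K"
    then show "x \<in> span (N \<union> w ` K)"
    proof
      assume "x \<in> (\<lambda>k. B k k) ` K"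
      then obtain k where "k \<in> K" "x = w k - v k" using B(3) by force
      then show ?thesis using B(2) by (auto intro!: span_diff intro: span_base)
    qed (auto intro: span_base)
  next
    fix x assume "x \<in> N \<union> w ` K"
    then show "x \<in> span (N \<union> (\<lambda>k. B k k) ` K)"
      using B(2,3) by (auto intro!: span_add intro: span_base)
  qed
  then have card: "card (span (N \<union> (\<lambda>k. B k k) ` K)) = CARD('a) ^ card K * card (span N)"
    using K(2,4) assms(5) by (simp add: span_eq_iff[THEN iffD2])
  have "finite K" using K(1) assms(1) finite_subset by auto
  then have "\<exists>X\<in>S. (\<forall>i\<in>J. (\<forall>k\<in>K. i < k) \<longrightarrow> X i \<in> N) \<and>
      card (span (N \<union> (\<lambda>k. Z k + X k) ` K)) = CARD('a) ^ card K * card (span N)"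
    using K(1) assms(4,5) S0 S_add B(1) card span_superset[of N]
    by (intro ex_independent_columns[where B = B]) (auto simp: S'_def)
  then obtain X where X: "X \<in> S" "card (span (N \<union> (\<lambda>k. Z k + X k) ` K)) = CARD('a) ^ Suc r * card N"
    using K(2) assms(5) by (auto simp: span_eq_iff[THEN iffD2])
  have "card (span (N \<union> (\<lambda>k. Z k + X k) ` K)) \<le> card (span (N \<union> (Z + X) ` J))"
    using K(1) assms(1,4) by (intro card_mono finite_span span_mono) auto
  then have "CARD('a) ^ Suc r * card N \<le> CARD('a) ^ r * card N"
    using rank[OF X(1)] X(2) by linarith
  then show False using cN CARD_field_gt_1[where 'a='a] by simp
qed

end

section \<open>Subspaces of optimal anticodes\<close>

interpretation fn: finite_scalars "\<lambda>c (f :: nat \<Rightarrow> 'a::{field,finite}) i. c * f i"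
  by unfold_locales (auto simp: fun_eq_iff algebra_simps)

lemma sum_fun_apply: "sum f A x = (\<Sum>a\<in>A. f a x)"
  by (induction A rule: infinite_finite_induct) auto

definition supported_on :: "nat set \<Rightarrow> (nat \<Rightarrow> 'a::zero) set" where
  "supported_on I = {f. \<forall>i. i \<notin> I \<longrightarrow> f i = 0}"

lemma finite_card_supported_on:
  assumes "finite I"
  shows "finite (supported_on I :: (nat \<Rightarrow> 'a::{field,finite}) set)"
    and "card (supported_on I :: (nat \<Rightarrow> 'a) set) = CARD('a) ^ card I"
proof -
  have bij: "bij_betw (\<lambda>f. restrict f I) (supported_on I) (I \<rightarrow>\<^sub>E (UNIV :: 'a set))"
    by (intro bij_betw_byWitness[where f' = "\<lambda>g i. if i \<in> I then g i else 0"])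
      (auto simp: supported_on_def fun_eq_iff PiE_def extensional_def)
  have "finite (I \<rightarrow>\<^sub>E (UNIV :: 'a set))" using assms by (intro finite_PiE) auto
  then show "finite (supported_on I :: (nat \<Rightarrow> 'a) set)" using bij_betw_finite[OF bij] by simp
  show "card (supported_on I :: (nat \<Rightarrow> 'a) set) = CARD('a) ^ card I"
    using bij_betw_same_card[OF bij] assms by (simp add: card_PiE)
qed

lemma subspace_supported_on: "fn.subspace (supported_on I)"
  by (auto simp: fn.subspace_def supported_on_def)

text \<open>Tensors with independent second factors form a direct sum: the coefficients can be
  compared at each \<open>j\<close> separately.\<close>

lemma tensor_inj:
  fixes w :: "'i \<Rightarrow> nat \<Rightarrow> 'a::{field,finite}" and L :: "'i \<Rightarrow> (nat \<Rightarrow> 'a) set"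
  assumes "finite I" and indep: "\<And>c. (\<And>l. (\<Sum>i\<in>I. c i * w i l) = 0) \<Longrightarrow> \<forall>i\<in>I. c i = 0"
  shows "inj_on (\<lambda>f j l. \<Sum>i\<in>I. f i j * w i l) (PiE I L)"
proof (rule inj_onI)
  fix f g assume fg: "f \<in> PiE I L" "g \<in> PiE I L"
    and eq: "(\<lambda>j l. \<Sum>i\<in>I. f i j * w i l) = (\<lambda>j l. \<Sum>i\<in>I. g i j * w i l)"
  have "\<forall>i\<in>I. f i j - g i j = 0" for j
    using fun_cong[OF fun_cong[OF eq, of j]]
    by (intro indep) (simp add: left_diff_distrib sum_subtractf)
  then show "f = g" using fg by (intro PiE_ext[of f I L g]) (auto simp: fun_eq_iff)
qed

text \<open>An optimal anticode of maximal rank \<open>u\<close>, with every matrix given as its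
  family of columns \<open>X j\<close> and every dimension replaced by a cardinality.\<close>

locale matrix_anticode =
  fixes m n u :: nat and A :: "(nat \<Rightarrow> nat \<Rightarrow> 'a::{field,finite}) set"
  assumes n_pos: "1 \<le> n" and n_le_m: "n \<le> m" and u_pos: "1 \<le> u"
    and fin: "finite A" and nonempty: "A \<noteq> {}"
    and diff: "\<And>X Y. X \<in> A \<Longrightarrow> Y \<in> A \<Longrightarrow> X - Y \<in> A"
    and scale: "\<And>X c. X \<in> A \<Longrightarrow> (\<lambda>j i. c * X j i) \<in> A"
    and supp: "\<And>X j. X \<in> A \<Longrightarrow> j < n \<Longrightarrow> X j \<in> supported_on {..<m}"
    and supp': "\<And>X j. X \<in> A \<Longrightarrow> n \<le> j \<Longrightarrow> X j = 0"
    and cardA: "card A = CARD('a) ^ (m * u)"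
    and rank: "\<And>X. X \<in> A \<Longrightarrow> card (fn.span (X ` {..<n})) \<le> CARD('a) ^ u"
begin

definition W where "W j = (\<lambda>X. X j) ` A"

definition S where "S j = {X \<in> A. X j = 0}"

text \<open>The \<open>f\<close> for which the rank one matrix \<open>w f\<^sup>T\<close> lies in \<open>S j\<close>.\<close>

definition L where
  "L j w = {f \<in> supported_on ({..<n} - {j}). (\<lambda>k i. f k * w i) \<in> A}"

lemma zero_mem: "0 \<in> A"
  using nonempty diff by (metis ex_in_conv diff_self)

lemma add: "X \<in> A \<Longrightarrow> Y \<in> A \<Longrightarrow> X + Y \<in> A"
  using diff[OF _ diff[OF zero_mem]] by fastforce

lemma W_subspace: "fn.subspace (W j)"
  unfolding fn.subspace_def W_def
proof (intro conjI ballI allI)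
  show "0 \<in> (\<lambda>X. X j) ` A" using zero_mem by (intro image_eqI[of _ _ 0]) auto
next
  fix x y assume "x \<in> (\<lambda>X. X j) ` A" "y \<in> (\<lambda>X. X j) ` A"
  then obtain X Y where "X \<in> A" "Y \<in> A" "x = X j" "y = Y j" by auto
  then show "x + y \<in> (\<lambda>X. X j) ` A" using add by (intro image_eqI[of _ _ "X + Y"]) auto
next
  fix c x assume "x \<in> (\<lambda>X. X j) ` A"
  then obtain X where "X \<in> A" "x = X j" by auto
  then show "(\<lambda>i. c * x i) \<in> (\<lambda>X. X j) ` A"
    using scale by (intro image_eqI[of _ _ "\<lambda>j i. c * X j i"]) auto
qed

lemma finite_W: "finite (W j)"
  using fin by (simp add: W_def)

lemma finite_S: "finite (S j)"
  using fin by (simp add: S_def)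

lemma W_supp: "j < n \<Longrightarrow> W j \<subseteq> supported_on {..<m}"
  using supp by (auto simp: W_def)

lemma card_A: "card A = card (W j) * card (S j)"
  unfolding W_def S_def using fin diff by (intro card_hom_image_kernel) auto

lemma card_W:
  assumes "j < n"
  obtains s where "card (W j) = CARD('a) ^ s" "s \<le> m"
proof -
  obtain B where "B \<subseteq> W j" "finite B" "fn.independent B" "fn.span B = W j"
    and B: "card (W j) = CARD('a) ^ card B"
    by (rule fn.finite_subspace_basis[OF finite_W W_subspace])
  have "CARD('a) ^ card B \<le> CARD('a) ^ m"
    using card_mono[OF finite_card_supported_on(1) W_supp[OF assms]]
    unfolding B by (simp add: finite_card_supported_on(2))
  then have "card B \<le> m" using CARD_field_gt_1[where 'a='a] power_le_imp_le_exp by blast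
  then show ?thesis using that B by blast
qed

lemma finite_L: "finite (L j w)"
  using finite_card_supported_on(1)[of "{..<n} - {j}"] by (auto simp: L_def intro: rev_finite_subset)

lemma L_subspace: "fn.subspace (L j w)"
  unfolding fn.subspace_def
proof (intro conjI ballI allI)
  show "0 \<in> L j w" using zero_mem by (auto simp: L_def supported_on_def zero_fun_def)
next
  fix x y assume *: "x \<in> L j w" "y \<in> L j w"
  then have "(\<lambda>k i. x k * w i) + (\<lambda>k i. y k * w i) \<in> A" by (intro add) (auto simp: L_def)
  moreover have "(\<lambda>k i. x k * w i) + (\<lambda>k i. y k * w i) = (\<lambda>k i. (x + y) k * w i)"
    by (auto simp: fun_eq_iff distrib_right)
  ultimately show "x + y \<in> L j w" using * by (auto simp: L_def supported_on_def)
next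
  fix c x assume *: "x \<in> L j w"
  then have "(\<lambda>k i. c * (x k * w i)) \<in> A" by (intro scale) (simp add: L_def)
  then have "(\<lambda>k i. c * x k * w i) \<in> A" by (simp only: mult.assoc)
  then show "(\<lambda>i. c * x i) \<in> L j w" using * by (simp add: L_def supported_on_def)
qed

lemma card_L_le: "j < n \<Longrightarrow> card (L j w) \<le> CARD('a) ^ (n - 1)"
  using card_mono[OF finite_card_supported_on(1)[of "{..<n} - {j}"], of "L j w"]
  by (auto simp: L_def finite_card_supported_on(2))

text \<open>The members of \<open>A\<close> with column \<open>j\<close> equal to \<open>w\<close>
  form a translate \<open>Z + S j\<close>. Their other columns have rank at most
  \<open>u - 1\<close> modulo \<open>w\<close> and live in a quotient of dimension
  \<open>m - 1\<close>, so the affine bound has exponent \<open>(m - 1) * (u - 1)\<close>. What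
  remains are the members of \<open>S j\<close> all of whose columns are multiples of
  \<open>w\<close>, which is what \<open>L j w\<close> counts. Since \<open>card A\<close> is the
  product of \<open>card (W j)\<close> and \<open>card (S j)\<close>, the exponent
  \<open>m + u - 1\<close> is what is left of \<open>m * u\<close>.\<close>

lemma card_L:
  assumes j: "j < n" and w: "w \<in> W j" "w \<noteq> 0"
  shows "CARD('a) ^ (m + u - 1) \<le> card (W j) * card (L j w)"
proof -
  let ?q = "CARD('a)"
  let ?J = "{..<n} - {j}" and ?N = "fn.span {w}"
  obtain Z where Z: "Z \<in> A" "Z j = w" using w by (auto simp: W_def)
  have cN: "card ?N = ?q"
    using fn.card_span_independent[of "{w}"] w(2) by simp
  have NU: "?N \<subseteq> supported_on {..<m}"
    using w W_supp[OF j] by (intro fn.span_minimal subspace_supported_on) auto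
  have "card (S j) \<le> card {X \<in> S j. \<forall>k\<in>?J. X k \<in> ?N} * ?q ^ ((m - 1) * (u - 1))"
  proof (rule fn.anticode_bound[where U = "supported_on {..<m}" and Z = Z])
    show "card ?J \<le> m - 1" using j n_le_m by simp
    show "finite ?N" by (rule fn.finite_span) simp
    show "S j \<noteq> {}" using zero_mem by (auto simp: S_def)
    have "Suc (m - 1) = m" using n_pos n_le_m by simp
    then show "card (supported_on {..<m} :: (nat \<Rightarrow> 'a) set) \<le> card ?N * ?q ^ (m - 1)"
      by (simp add: cN finite_card_supported_on power_Suc[symmetric])
    \<comment> \<open>Column \<open>j\<close> of \<open>Z + X\<close> is \<open>w\<close>, so the
      span of all columns contains \<open>w\<close>. One of the \<open>u\<close> dimensions is thus
      used up by \<open>?N\<close>.\<close>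
    show "card (fn.span (?N \<union> (Z + X) ` ?J)) \<le> ?q ^ (u - 1) * card ?N" if X: "X \<in> S j" for X
    proof -
      have "fn.span (?N \<union> (Z + X) ` ?J) \<subseteq> fn.span ((Z + X) ` {..<n})"
      proof (rule fn.span_minimal[OF _ fn.subspace_span])
        have "w = (Z + X) j" using X Z(2) by (simp add: S_def)
        then have "?N \<subseteq> fn.span ((Z + X) ` {..<n})" using j by (intro fn.span_mono) auto
        then show "?N \<union> (Z + X) ` ?J \<subseteq> fn.span ((Z + X) ` {..<n})" by (auto intro: fn.span_base)
      qed
      then have "card (fn.span (?N \<union> (Z + X) ` ?J)) \<le> card (fn.span ((Z + X) ` {..<n}))"
        by (intro card_mono fn.finite_span) auto
      also have "\<dots> \<le> ?q ^ u" using rank[OF add[OF Z(1)]] X by (auto simp: S_def)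
      also have "\<dots> = ?q ^ (u - 1) * card ?N" using u_pos by (simp add: cN power_eq_if)
      finally show ?thesis .
    qed
  qed (use NU subspace_supported_on supp diff in
      \<open>auto simp: S_def fin finite_card_supported_on fn.subspace_span\<close>)
  also have "card {X \<in> S j. \<forall>k\<in>?J. X k \<in> ?N} \<le> card (L j w)"
  proof (rule surj_card_le[OF finite_L])
    show "{X \<in> S j. \<forall>k\<in>?J. X k \<in> ?N} \<subseteq> (\<lambda>f k i. f k * w i) ` L j w"
    proof
      fix X assume X: "X \<in> {X \<in> S j. \<forall>k\<in>?J. X k \<in> ?N}"
      then have "\<forall>k\<in>?J. \<exists>c. X k = (\<lambda>i. c * w i)" by (auto simp: fn.span_singleton)
      then obtain c where c: "\<And>k. k \<in> ?J \<Longrightarrow> X k = (\<lambda>i. c k * w i)" by metis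
      define f where "f k = (if k \<in> ?J then c k else 0)" for k
      have "X k = (\<lambda>i. f k * w i)" for k
        using c[of k] X supp'[of X k] by (cases "k < n") (auto simp: f_def S_def fun_eq_iff)
      then have X': "X = (\<lambda>k i. f k * w i)" by auto
      then have "f \<in> L j w" using X by (auto simp: L_def S_def supported_on_def f_def)
      then show "X \<in> (\<lambda>f k i. f k * w i) ` L j w" using X' by auto
    qed
  qed
  finally have le: "card (S j) \<le> card (L j w) * ?q ^ ((m - 1) * (u - 1))" by simp
  have mu: "m * u = (m - 1) * (u - 1) + (m + u - 1)"
  proof -
    obtain m' u' where "m = Suc m'" "u = Suc u'" using n_pos n_le_m u_pos
      by (metis Suc_le_D le_trans One_nat_def)
    then show ?thesis by simp
  qed
  have "?q ^ ((m - 1) * (u - 1)) * ?q ^ (m + u - 1) = card (W j) * card (S j)"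
    using card_A[of j] cardA mu by (simp add: power_add)
  also have "\<dots> \<le> card (W j) * (card (L j w) * ?q ^ ((m - 1) * (u - 1)))"
    using le by (rule mult_left_mono) simp
  also have "\<dots> = ?q ^ ((m - 1) * (u - 1)) * (card (W j) * card (L j w))" by simp
  finally show ?thesis by (simp add: CARD_field_gt_1)
qed

lemma tensor_mem:
  assumes "finite I" "f \<in> PiE I (\<lambda>i. L j (w i))"
  shows "(\<lambda>k l. \<Sum>i\<in>I. f i k * w i l) \<in> S j"
proof -
  have "(\<lambda>k l. \<Sum>i\<in>I'. f i k * w i l) \<in> A" if "finite I'" "I' \<subseteq> I" for I'
    using that
  proof (induction I' rule: finite_induct)
    case empty
    then show ?case using zero_mem by (simp add: zero_fun_def)
  next
    case (insert i I')
    then have "f i \<in> L j (w i)" using assms(2) by auto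
    then have "(\<lambda>k l. f i k * w i l) + (\<lambda>k l. \<Sum>i\<in>I'. f i k * w i l) \<in> A"
      using insert by (intro add) (auto simp: L_def)
    moreover have "(\<lambda>k l. f i k * w i l) + (\<lambda>k l. \<Sum>i\<in>I'. f i k * w i l)
        = (\<lambda>k l. \<Sum>i\<in>insert i I'. f i k * w i l)"
      using insert by (auto simp: fun_eq_iff)
    ultimately show ?case by simp
  qed
  moreover have "f i j = 0" if "i \<in> I" for i
    using assms(2) that by (fastforce simp: L_def supported_on_def PiE_iff)
  ultimately show ?thesis using assms(1) by (auto simp: S_def fun_eq_iff)
qed

text \<open>Sums of rank one matrices with independent directions \<open>w i\<close> stay in
  \<open>S j\<close>, and different choices of the factors give different sums.\<close>

lemma prod_card_L_le:
  assumes "finite I" "\<And>c. (\<And>l. (\<Sum>i\<in>I. c i * w i l) = 0) \<Longrightarrow> \<forall>i\<in>I. c i = 0"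
  shows "(\<Prod>i\<in>I. card (L j (w i))) \<le> card (S j)"
proof -
  have "(\<Prod>i\<in>I. card (L j (w i))) = card (PiE I (\<lambda>i. L j (w i)))"
    using assms(1) by (simp add: card_PiE)
  also have "\<dots> = card ((\<lambda>f k l. \<Sum>i\<in>I. f i k * w i l) ` PiE I (\<lambda>i. L j (w i)))"
    using tensor_inj[OF assms] by (simp add: card_image)
  also have "\<dots> \<le> card (S j)"
    using tensor_mem[OF assms(1)] finite_S by (intro card_mono) auto
  finally show ?thesis .
qed

text \<open>If \<open>s\<close> is the dimension of \<open>W j\<close>, counting the matrices \<open>w f\<^sup>T\<close> gives \<open>m + u \<le> s + n\<close> and
  \<open>(s - u) * (m - s) \<le> 0\<close>.\<close>

lemma column_dichotomy:
  assumes j: "j < n" and W: "W j \<noteq> {0}" "card (W j) \<noteq> CARD('a) ^ m"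
  shows "m = n" "card (W j) = CARD('a) ^ u"
proof -
  let ?q = "CARD('a)"
  have q: "1 < ?q" by (rule CARD_field_gt_1)
  obtain s where s: "card (W j) = ?q ^ s" "s \<le> m" using card_W[OF j] .
  have sm: "s < m" using s W(2) by (cases "s = m") auto
  have "0 \<in> W j" using fn.subspace_0[OF W_subspace] .
  then obtain w where w: "w \<in> W j" "w \<noteq> 0" using W(1) by auto
  have "?q ^ (m + u - 1) \<le> ?q ^ (s + (n - 1))"
    using order_trans[OF card_L[OF j w] mult_left_mono[OF card_L_le[OF j]]] s by (simp add: power_add)
  then have "m + u - 1 \<le> s + (n - 1)" using q power_le_imp_le_exp by blast
  then have mu: "m + u \<le> s + n" using n_pos u_pos by simp
  obtain B where B: "B \<subseteq> W j" "finite B" "fn.independent B" "fn.span B = W j" "card (W j) = ?q ^ card B"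
    by (rule fn.finite_subspace_basis[OF finite_W W_subspace])
  have cB: "card B = s" using B(5) s(1) q by simp
  have "(\<Prod>w\<in>B. card (L j w)) \<le> card (S j)"
  proof (rule prod_card_L_le[OF B(2)])
    fix c :: "(nat \<Rightarrow> 'a) \<Rightarrow> 'a" assume "\<And>l. (\<Sum>w\<in>B. c w * w l) = 0"
    then have "(\<Sum>w\<in>B. (\<lambda>i. c w * w i)) = 0" by (auto simp: fun_eq_iff sum_fun_apply)
    then show "\<forall>w\<in>B. c w = 0" using fn.independentD[OF B(3,2) subset_refl] by auto
  qed
  moreover have "w \<in> W j" "w \<noteq> 0" if "w \<in> B" for w
    using that B fn.dependent_zero by auto
  then have "(\<Prod>w\<in>B. ?q ^ (m + u - 1)) \<le> (\<Prod>w\<in>B. ?q ^ s * card (L j w))"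
    using card_L[OF j] s(1) by (intro prod_mono) auto
  then have "?q ^ ((m + u - 1) * s) \<le> ?q ^ (s * s) * (\<Prod>w\<in>B. card (L j w))"
    by (simp add: prod.distrib cB power_mult)
  ultimately have "?q ^ ((m + u - 1) * s) \<le> ?q ^ (s * s) * card (S j)"
    by (meson le_trans mult_le_mono2)
  \<comment> \<open>The additional factor q^s completes \<open>card (S j)\<close> to
    \<open>card A\<close>, whose exponent is known.\<close>
  then have "?q ^ s * ?q ^ ((m + u - 1) * s) \<le> ?q ^ (s * s) * (?q ^ s * card (S j))"
    by (simp add: mult.left_commute)
  also have "?q ^ s * card (S j) = ?q ^ (m * u)" using card_A[of j] cardA s(1) by simp
  finally have "?q ^ (s + (m + u - 1) * s) \<le> ?q ^ (s * s + m * u)" by (simp add: power_add)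
  then have "s + (m + u - 1) * s \<le> s * s + m * u" using q power_le_imp_le_exp by blast
  then have "Suc (m + u - 1) * s \<le> s * s + m * u" by (simp only: mult_Suc)
  then have ineq: "(m + u) * s \<le> s * s + m * u" using u_pos by simp
  obtain a b where ab: "m = s + a" "a > 0" "s = u + b"
    using sm mu n_le_m by (metis add_le_imp_le_right add.commute le_trans less_imp_add_positive nat_le_iff_add nat_add_left_cancel_le)
  have "b = 0" using ineq ab by (auto simp: algebra_simps)
  then have "s = u" using ab by simp
  then show "m = n" "card (W j) = ?q ^ u" using mu n_le_m s(1) by auto
qed

text \<open>When column \<open>j\<close> takes all values, \<open>card_L\<close> gives every
  \<open>L j w\<close> with nonzero \<open>w\<close> of height \<open>m\<close> at least q^(u-1)
  elements, while the \<open>m\<close> unit directions together have room for exactly q^((u-1)m) in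
  \<open>S j\<close>. So all these estimates are equalities, and the rows of the members of
  \<open>S j\<close> range independently over the spaces \<open>L j (e i)\<close>. Comparison with
  the directions \<open>e 0 + e i\<close> shows that these row spaces coincide. All rows thus lie in
  one space of dimension \<open>u - 1\<close>.\<close>

lemma rank_le_of_full_column:
  assumes j: "j < n" and W: "card (W j) = CARD('a) ^ m" and X: "X \<in> S j"
  shows "card (fn.span (X ` {..<n})) \<le> CARD('a) ^ (u - 1)"
proof -
  let ?q = "CARD('a)"
  have q: "1 < ?q" by (rule CARD_field_gt_1)
  define e where "e i l = (if l = i then 1 else 0 :: 'a)" for i l :: nat
  have W': "W j = supported_on {..<m}"
    using W W_supp[OF j] by (intro card_subset_eq) (auto simp: finite_card_supported_on)
  have cL: "?q ^ (u - 1) \<le> card (L j w)" if "w \<in> supported_on {..<m}" "w \<noteq> 0" for w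
  proof -
    have "m + u - 1 = m + (u - 1)" using u_pos by simp
    then have "?q ^ m * ?q ^ (u - 1) \<le> ?q ^ m * card (L j w)"
      using card_L[OF j, of w] that W W' by (simp add: power_add)
    then show ?thesis using q by simp
  qed
  have e: "e i \<in> supported_on {..<m}" "e i \<noteq> 0" if "i < m" for i
    using that by (auto simp: e_def supported_on_def fun_eq_iff)
  have e_sum: "(\<Sum>i<m. c i * e i l) = (if l < m then c l else 0)" for c l
    by (simp add: e_def if_distrib cong: if_cong)
  have indep: "\<forall>i\<in>{..<m}. c i = 0" if "\<And>l. (\<Sum>i<m. c i * e i l) = 0" for c
    using that unfolding e_sum by (metis lessThan_iff)
  have cS: "card (S j) = (?q ^ (u - 1)) ^ m"
  proof -
    have "?q ^ m * card (S j) = ?q ^ m * (?q ^ (u - 1)) ^ m"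
      using card_A[of j] cardA W u_pos
      by (cases u) (auto simp: power_add power_mult[symmetric] mult.commute)
    then show ?thesis using q by simp
  qed
  have prod: "(\<Prod>i<m. card (L j (e i))) \<le> (?q ^ (u - 1)) ^ m"
    unfolding cS[symmetric] by (rule prod_card_L_le) (auto intro: indep[rule_format])
  have cLe: "card (L j (e i)) = ?q ^ (u - 1)" if i: "i < m" for i
  proof (rule ccontr)
    assume "\<not> ?thesis"
    then have "?q ^ (u - 1) < card (L j (e i))" using cL[OF e[OF i]] by simp
    then have "?q ^ (u - 1) * (\<Prod>k\<in>{..<m} - {i}. ?q ^ (u - 1))
        < card (L j (e i)) * (\<Prod>k\<in>{..<m} - {i}. ?q ^ (u - 1))"
      using q by (intro mult_strict_right_mono prod_pos) auto
    also have "\<dots> \<le> card (L j (e i)) * (\<Prod>k\<in>{..<m} - {i}. card (L j (e k)))"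
      using cL e by (intro mult_left_mono prod_mono) auto
    finally have "(\<Prod>i<m. ?q ^ (u - 1)) < (\<Prod>i<m. card (L j (e i)))"
      using i by (simp only: prod.remove[of "{..<m}" i] finite_lessThan lessThan_iff)
    then show False using prod by simp
  qed
  have inj: "inj_on (\<lambda>f k l. \<Sum>i<m. f i k * e i l) (PiE {..<m} (\<lambda>i. L j (e i)))"
    by (rule tensor_inj) (auto intro: indep[rule_format])
  have "(\<lambda>f k l. \<Sum>i<m. f i k * e i l) ` PiE {..<m} (\<lambda>i. L j (e i)) = S j"
    using tensor_mem[of "{..<m}" _ j e] inj
    by (intro card_subset_eq finite_S) (auto simp: card_image card_PiE cLe cS)
  then have image: "S j = (\<lambda>f k l. if l < m then f l k else 0) ` PiE {..<m} (\<lambda>i. L j (e i))"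
    by (simp only: e_sum)
  have row: "(\<lambda>k. Y k i) \<in> L j (e i)" if Y: "Y \<in> S j" and i: "i < m" for Y i
  proof -
    obtain f where f: "f \<in> PiE {..<m} (\<lambda>i. L j (e i))" "Y = (\<lambda>k l. if l < m then f l k else 0)"
      using Y unfolding image by auto
    then have "(\<lambda>k. Y k i) = f i" using i by auto
    then show ?thesis using f(1) i by auto
  qed
  have L_eq: "L j (e i) = L j (e 0)" if i: "i < m" "i \<noteq> 0" for i
  proof -
    \<comment> \<open>A rank one matrix with direction \<open>e 0 + e i\<close> has the same row at
      \<open>0\<close> and at \<open>i\<close>, so that row lies in both row spaces. The sizes
      agree, which turns both inclusions into equalities.\<close>
    have sub: "L j (e 0 + e i) \<subseteq> L j (e i') " if i': "i' = 0 \<or> i' = i" for i'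
    proof
      fix g assume g: "g \<in> L j (e 0 + e i)"
      then have "(\<lambda>k l. g k * (e 0 + e i) l) \<in> S j"
        by (auto simp: L_def S_def supported_on_def fun_eq_iff)
      from row[OF this, of i'] show "g \<in> L j (e i')" using i i' by (auto simp: e_def)
    qed
    have "e 0 + e i \<in> supported_on {..<m}" "e 0 + e i \<noteq> 0"
      using i by (auto simp: e_def supported_on_def fun_eq_iff intro!: exI[of _ i])
    from cL[OF this] have "L j (e 0 + e i) = L j (e i')" if "i' = 0 \<or> i' = i" for i'
      using sub[OF that] that i cLe[of i'] by (intro card_seteq finite_L) auto
    then show ?thesis by metis
  qed
  obtain F where "F \<subseteq> L j (e 0)" "fn.independent F"
    and F: "finite F" "fn.span F = L j (e 0)" "card (L j (e 0)) = ?q ^ card F"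
    by (rule fn.finite_subspace_basis[OF finite_L L_subspace])
  have cF: "card F = u - 1" using F(3) cLe[of 0] n_pos n_le_m q by simp
  have "\<exists>c. \<forall>k. X k i = (\<Sum>f\<in>F. c f * f k)" if "i < m" for i
  proof -
    have "(\<lambda>k. X k i) \<in> fn.span F" using row[OF X that] L_eq[OF that] F(2) by metis
    then obtain c where "(\<lambda>k. X k i) = (\<Sum>f\<in>F. (\<lambda>k. c f * f k))"
      unfolding fn.span_finite[OF F(1)] by auto
    then show ?thesis by (auto simp: fun_eq_iff sum_fun_apply)
  qed
  then obtain c where c: "\<And>i k. i < m \<Longrightarrow> X k i = (\<Sum>f\<in>F. c i f * f k)" by metis
  \<comment> \<open>Row rank bounds column rank: with the rows written in the basis
    \<open>F\<close>, the columns are combinations of the \<open>card F\<close> coefficient vectors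
    \<open>v f\<close>.\<close>
  define v where "v f i = (if i < m then c i f else 0)" for f i
  have "X k \<in> fn.span (v ` F)" if "k < n" for k
  proof -
    have "X k i = 0" if "\<not> i < m" for i
      using supp[of X k] X \<open>k < n\<close> that by (auto simp: S_def supported_on_def)
    then have "X k i = (\<Sum>f\<in>F. f k * v f i)" for i
      by (cases "i < m") (auto simp: c v_def mult.commute)
    then have "X k = (\<Sum>f\<in>F. (\<lambda>i. f k * v f i))" by (simp add: fun_eq_iff sum_fun_apply)
    also have "\<dots> \<in> fn.span (v ` F)"
      by (intro fn.span_sum fn.span_scale fn.span_base) auto
    finally show ?thesis .
  qed
  then have "fn.span (X ` {..<n}) \<subseteq> fn.span (v ` F)"
    by (intro fn.span_minimal fn.subspace_span) auto
  then have "card (fn.span (X ` {..<n})) \<le> card (fn.span (v ` F))"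
    using F(1) by (intro card_mono fn.finite_span) auto
  also have "\<dots> \<le> ?q ^ card (v ` F)" using F(1) by (intro fn.card_span_le) auto
  also have "\<dots> \<le> ?q ^ (u - 1)"
    using card_image_le[OF F(1), of v] cF q by (intro power_increasing) auto
  finally show ?thesis .
qed

text \<open>A column that takes all values can be killed. If there is none, every nonzero column is
  in the exceptional case of \<open>column_dichotomy\<close>, so blocks are square and such columns
  have exactly \<open>u\<close> dimensions. Then all columns run through one common space of
  dimension \<open>u\<close>. Killing a row costs at most \<open>n = m\<close> dimensions and cuts
  that space down.\<close>

theorem sub_anticode:
  "(\<exists>j<n. card A \<le> CARD('a) ^ m * card {X \<in> A. X j = 0} \<and>
      (\<forall>X\<in>{X \<in> A. X j = 0}. card (fn.span (X ` {..<n})) \<le> CARD('a) ^ (u - 1))) \<or>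
   (\<exists>i<m. card A \<le> CARD('a) ^ m * card {X \<in> A. \<forall>j<n. X j i = 0} \<and>
      (\<forall>X\<in>{X \<in> A. \<forall>j<n. X j i = 0}. card (fn.span (X ` {..<n})) \<le> CARD('a) ^ (u - 1)))"
proof (cases "\<exists>j<n. card (W j) = CARD('a) ^ m")
  case True
  then obtain j where "j < n" "card (W j) = CARD('a) ^ m" by auto
  then show ?thesis using rank_le_of_full_column[of j] card_A[of j] unfolding S_def by auto
next
  case False
  let ?q = "CARD('a)"
  have q: "1 < ?q" by (rule CARD_field_gt_1)
  have dich: "m = n \<and> card (W j) = ?q ^ u" if "j < n" "W j \<noteq> {0}" for j
    using column_dichotomy[OF that] False that(1) by blast
  have "\<exists>j<n. W j \<noteq> {0}"
  proof (rule ccontr)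
    assume "\<not> ?thesis"
    then have "X j = 0" if "X \<in> A" for X j using that supp'[OF that, of j] by (cases "j < n") (auto simp: W_def)
    then have "A \<subseteq> {0}" by (auto simp: fun_eq_iff)
    then have "card A \<le> 1" using card_mono[of "{0}" A] by simp
    moreover have "1 < ?q ^ (m * u)" using q u_pos n_pos n_le_m by (intro one_less_power) auto
    ultimately show False using cardA by simp
  qed
  then obtain j0 where j0: "j0 < n" "W j0 \<noteq> {0}" by blast
  note mn = dich[OF j0, THEN conjunct1] and cW = dich[OF j0, THEN conjunct2]
  have "W j0 \<subseteq> W j" if j: "j < n" "j \<noteq> j0" for j
  proof
    fix w assume w: "w \<in> W j0"
    show "w \<in> W j"
    proof (cases "w = 0")
      case True
      then show ?thesis using fn.subspace_0[OF W_subspace] by simp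
    next
      case False
      \<comment> \<open>For \<open>m = n\<close> the lower bound leaves \<open>L j0 w\<close> no
        choice but to be the whole space supported off \<open>j0\<close>. In particular the matrix
        with \<open>w\<close> in column \<open>j\<close> and zeros elsewhere belongs to
        \<open>A\<close>.\<close>
      have "m + u - 1 = u + (n - 1)" using mn n_pos by simp
      then have "?q ^ u * ?q ^ (n - 1) \<le> ?q ^ u * card (L j0 w)"
        using card_L[OF j0(1) w False] cW by (simp add: power_add)
      then have "?q ^ (n - 1) \<le> card (L j0 w)" using q by simp
      then have "L j0 w = supported_on ({..<n} - {j0})"
        using j0(1) by (intro card_seteq) (auto simp: finite_card_supported_on L_def)
      moreover have "(\<lambda>k. if k = j then 1 else 0) \<in> supported_on ({..<n} - {j0})"
        using j by (auto simp: supported_on_def)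
      ultimately have "(\<lambda>k i. (if k = j then 1 else 0) * w i) \<in> A" by (auto simp: L_def)
      then show ?thesis unfolding W_def by (rule rev_image_eqI) auto
    qed
  qed
  moreover have "card (W j) = ?q ^ u" if "j < n" "W j0 \<subseteq> W j" for j
  proof -
    have "W j \<noteq> {0}" using that(2) j0(2) fn.subspace_0[OF W_subspace, of j0] by auto
    then show ?thesis using dich that(1) by blast
  qed
  ultimately have W_eq: "W j = W j0" if "j < n" for j
    using that cW card_subset_eq[OF finite_W, of "W j0" j] by (metis order_refl)
  obtain w where w: "w \<in> W j0" "w \<noteq> 0" using j0(2) fn.subspace_0[OF W_subspace, of j0] by auto
  \<comment> \<open>The row is one in which the common column space is not identically zero, so that
    vanishing at \<open>i\<close> lowers its dimension from \<open>u\<close> to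
    \<open>u - 1\<close>.\<close>
  then obtain i where i: "w i \<noteq> 0" by (auto simp: fun_eq_iff)
  have im: "i < m" using w W_supp[OF j0(1)] i by (auto simp: supported_on_def)
  let ?A = "{X \<in> A. \<forall>j<n. X j i = 0}"
  have "(\<lambda>X j. X j i) ` A \<subseteq> supported_on {..<n}" using supp' by (auto simp: supported_on_def)
  then have le: "card ((\<lambda>X j. X j i) ` A) \<le> ?q ^ m"
    using card_mono[OF finite_card_supported_on(1), of "{..<n}" "(\<lambda>X j. X j i) ` A"] mn
    by (simp add: finite_card_supported_on(2))
  have ker: "{X \<in> A. (\<lambda>j. X j i) = 0} = ?A"
    using supp' by (auto simp: fun_eq_iff) (metis not_le zero_fun_apply)
  have "card A = card ((\<lambda>X j. X j i) ` A) * card {X \<in> A. (\<lambda>j. X j i) = 0}"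
    using fin diff by (intro card_hom_image_kernel) (auto simp: fun_eq_iff)
  also have "\<dots> \<le> ?q ^ m * card ?A" unfolding ker by (rule mult_right_mono[OF le]) simp
  finally have card: "card A \<le> ?q ^ m * card ?A" .
  have "card (fn.span (X ` {..<n})) \<le> ?q ^ (u - 1)" if X: "X \<in> ?A" for X
  proof -
    let ?W = "{v \<in> W j0. v i = 0}"
    have "card (W j0) = card ((\<lambda>v. v i) ` W j0) * card ?W"
      using finite_W fn.subspace_diff[OF W_subspace] by (intro card_hom_image_kernel) auto
    moreover have "(\<lambda>v. v i) ` W j0 = UNIV"
    proof -
      have "c \<in> (\<lambda>v. v i) ` W j0" for c
        using i fn.subspace_scale[OF W_subspace w(1), of "c / w i"]
        by (intro image_eqI[of _ _ "\<lambda>l. (c / w i) * w l"]) auto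
      then show ?thesis by auto
    qed
    ultimately have cW': "card ?W = ?q ^ (u - 1)" using cW u_pos q by (cases u) auto
    have sub: "fn.subspace ?W"
      using W_subspace[of j0] by (auto simp: fn.subspace_def)
    have "X ` {..<n} \<subseteq> ?W" using X W_eq by (force simp: W_def)
    then have "fn.span (X ` {..<n}) \<subseteq> ?W" using sub by (intro fn.span_minimal) auto
    then show ?thesis using card_mono[of ?W] finite_W cW' by auto
  qed
  then show ?thesis using card im by blast
qed

end

lemma matrix_anticode_bound:
  fixes A :: "(nat \<Rightarrow> nat \<Rightarrow> 'a::{field,finite}) set"
  assumes "n \<le> m" "finite A" "A \<noteq> {}" "\<And>X Y. X \<in> A \<Longrightarrow> Y \<in> A \<Longrightarrow> X - Y \<in> A"
    and supp: "\<And>X j. X \<in> A \<Longrightarrow> j < n \<Longrightarrow> X j \<in> supported_on {..<m}"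
    and supp': "\<And>X j. X \<in> A \<Longrightarrow> n \<le> j \<Longrightarrow> X j = 0"
    and rank: "\<And>X. X \<in> A \<Longrightarrow> card (fn.span (X ` {..<n})) \<le> CARD('a) ^ r"
  shows "card A \<le> CARD('a) ^ (m * r)"
proof -
  have "card A \<le> card {X \<in> A. \<forall>j\<in>{..<n}. X j \<in> {0}} * CARD('a) ^ (m * r)"
  proof (rule fn.anticode_bound[where U = "supported_on {..<m}" and Z = 0])
    show "card (fn.span ({0} \<union> (0 + X) ` {..<n})) \<le> CARD('a) ^ r * card {0 :: nat \<Rightarrow> 'a}"
      if "X \<in> A" for X
      using rank[OF that] by (simp add: fn.span_insert_0)
  qed (use assms in \<open>auto simp: finite_card_supported_on fn.subspace_0 subspace_supported_on\<close>)
  also have "\<dots> \<le> 1 * CARD('a) ^ (m * r)"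
  proof (rule mult_right_mono)
    have "{X \<in> A. \<forall>j\<in>{..<n}. X j \<in> {0}} \<subseteq> {0}"
      using supp' by (auto simp: fun_eq_iff) (metis lessThan_iff not_le)
    from card_mono[OF _ this] show "card {X \<in> A. \<forall>j\<in>{..<n}. X j \<in> {0}} \<le> 1" by simp
  qed simp
  finally show ?thesis by simp
qed

section \<open>Optimal anticodes\<close>

lemma card_carrier_eq_power_dim:
  fixes V :: "('a::{field,finite}, 'v, 'z) module_scheme"
  assumes "vectorspace class_ring V" "finite (carrier V)"
  shows "card (carrier V) = CARD('a) ^ vectorspace.dim class_ring V"
proof -
  interpret vectorspace class_ring V by fact
  have "fin_dim" unfolding fin_dim_def
    using assms(2) span_is_subset2[of "carrier V"] in_own_span[of "carrier V"] by blast
  then obtain B where B: "finite B" "basis B" using finite_basis_exists by auto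
  then have BV: "B \<subseteq> carrier V" by (simp add: basis_def)
  have ex1: "\<exists>!a. a \<in> B \<rightarrow>\<^sub>E UNIV \<and> lincomb a B = v" if "v \<in> carrier V" for v
    using B basis_criterion[OF B(1) BV] that by auto
  have closed: "lincomb a B \<in> carrier V" for a using BV by (intro lincomb_closed) auto
  have "bij_betw (\<lambda>a. lincomb a B) (B \<rightarrow>\<^sub>E (UNIV :: 'a set)) (carrier V)"
    unfolding bij_betw_def
  proof
    show "inj_on (\<lambda>a. lincomb a B) (B \<rightarrow>\<^sub>E (UNIV :: 'a set))"
    proof (rule inj_onI)
      fix a b assume ab: "a \<in> B \<rightarrow>\<^sub>E (UNIV :: 'a set)" "b \<in> B \<rightarrow>\<^sub>E (UNIV :: 'a set)" "lincomb a B = lincomb b B"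
      obtain c where c: "\<forall>d. d \<in> B \<rightarrow>\<^sub>E (UNIV :: 'a set) \<and> lincomb d B = lincomb a B \<longrightarrow> d = c"
        using ex1[OF closed[of a]] unfolding Ex1_def by (elim exE conjE) (rule that)
      have "a = c" "b = c" by (rule c[rule_format], simp add: ab)+
      then show "a = b" by simp
    qed
    show "(\<lambda>a. lincomb a B) ` (B \<rightarrow>\<^sub>E (UNIV :: 'a set)) = carrier V"
    proof
      show "carrier V \<subseteq> (\<lambda>a. lincomb a B) ` (B \<rightarrow>\<^sub>E (UNIV :: 'a set))"
        using ex1 by (blast dest: ex1_implies_ex)
    qed (use closed in auto)
  qed
  from bij_betw_same_card[OF this] show ?thesis
    using B dim_basis by (simp add: card_PiE)
qed

lemma card_subspace_eq_power_dim:
  fixes V :: "('a::{field,finite}, 'v, 'z) module_scheme"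
  assumes "subspace class_ring C V" "finite C"
  shows "card C = CARD('a) ^ vectorspace.dim class_ring (V\<lparr>carrier := C\<rparr>)"
proof -
  have "vectorspace class_ring V" using assms(1) by (simp add: subspace_def)
  from card_carrier_eq_power_dim[OF vectorspace.subspace_is_vs[OF this assms(1)]] assms(2)
  show ?thesis by simp
qed

text \<open>The dimension formula as an inequality: addition maps \<open>G \<times> H\<close> into
  \<open>K\<close>, and subtracting a fixed member embeds each nonempty fibre into
  \<open>G \<inter> H\<close>.\<close>

lemma card_subspaces_Int:
  fixes V :: "('a::{field,finite}, 'v, 'z) module_scheme"
  assumes G: "subspace class_ring G V" and H: "subspace class_ring H V" and K: "subspace class_ring K V"
    and sub: "G \<subseteq> K" "H \<subseteq> K" and finK: "finite K"
  shows "card G * card H \<le> card K * card (G \<inter> H)"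
proof -
  have "vectorspace class_ring V" using G by (simp add: subspace_def)
  then interpret vectorspace class_ring V .
  have smc: "submodule class_ring G V" "submodule class_ring H V" "submodule class_ring K V"
    using G H K by (auto simp: subspace_def)
  have GV: "G \<subseteq> carrier V" and HV: "H \<subseteq> carrier V" using smc by (auto simp: submodule_def)
  have minus: "x \<ominus>\<^bsub>V\<^esub> y \<in> W" if "submodule class_ring W V" "x \<in> W" "y \<in> W" for x y W
  proof -
    have "y \<in> carrier V" using that by (auto simp: submodule_def)
    then have "(\<ominus>\<^bsub>class_ring\<^esub> \<one>\<^bsub>class_ring\<^esub>) \<odot>\<^bsub>V\<^esub> y = \<ominus>\<^bsub>V\<^esub> y"
      by (rule smult_minus_1)
    then have "\<ominus>\<^bsub>V\<^esub> y \<in> W" using that(1,3) by (metis UNIV_I partial_object.select_convs(1) submodule.smult_closed)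
    then show ?thesis using that unfolding a_minus_def by (simp add: submodule.m_closed)
  qed
  have "card (G \<times> H) \<le> card K * card (G \<inter> H)"
  proof (rule card_le_fibers[where f = "\<lambda>(x, y). x \<oplus>\<^bsub>V\<^esub> y"])
    show "finite (G \<times> H)" "finite K"
      using finite_subset[OF sub(1) finK] finite_subset[OF sub(2) finK] finK by auto
    show "(\<lambda>(x, y). x \<oplus>\<^bsub>V\<^esub> y) ` (G \<times> H) \<subseteq> K"
      using sub submodule.m_closed[OF smc(3)] by auto
    fix z
    show "card {p \<in> G \<times> H. (case p of (x, y) \<Rightarrow> x \<oplus>\<^bsub>V\<^esub> y) = z} \<le> card (G \<inter> H)" (is "card ?F \<le> _")
    proof (cases "?F = {}")
      case True
      then show ?thesis by (simp only: card.empty)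
    next
      case False
      then obtain x0 y0 where 0: "x0 \<in> G" "y0 \<in> H" "x0 \<oplus>\<^bsub>V\<^esub> y0 = z" by auto
      have fin': "finite (G \<inter> H)" using sub finK by (auto intro: finite_subset)
      have *: "x \<ominus>\<^bsub>V\<^esub> x0 = y0 \<ominus>\<^bsub>V\<^esub> y" if "x \<in> G" "y \<in> H" "x \<oplus>\<^bsub>V\<^esub> y = z" for x y
      proof -
        have c: "x \<in> carrier V" "y \<in> carrier V" "x0 \<in> carrier V" "y0 \<in> carrier V"
          using 0 that GV HV by auto
        have "x \<oplus>\<^bsub>V\<^esub> \<ominus>\<^bsub>V\<^esub> x0 = (x \<oplus>\<^bsub>V\<^esub> y) \<oplus>\<^bsub>V\<^esub> (\<ominus>\<^bsub>V\<^esub> y \<oplus>\<^bsub>V\<^esub> \<ominus>\<^bsub>V\<^esub> x0)"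
          using c by (simp add: M.a_assoc M.r_neg2)
        also have "\<dots> = (y0 \<oplus>\<^bsub>V\<^esub> x0) \<oplus>\<^bsub>V\<^esub> (\<ominus>\<^bsub>V\<^esub> x0 \<oplus>\<^bsub>V\<^esub> \<ominus>\<^bsub>V\<^esub> y)"
          using c 0(3) that(3) by (simp add: M.a_comm)
        also have "\<dots> = y0 \<oplus>\<^bsub>V\<^esub> \<ominus>\<^bsub>V\<^esub> y"
          using c by (simp add: M.a_assoc M.r_neg2)
        finally show ?thesis by (simp add: a_minus_def)
      qed
      show ?thesis
      proof (rule card_inj_on_le[OF _ _ fin'])
        show "inj_on (\<lambda>(x, y). x \<ominus>\<^bsub>V\<^esub> x0) ?F"
        proof (rule inj_onI, clarify)
          fix x y x' y' assume h: "x \<in> G" "y \<in> H" "x' \<in> G" "y' \<in> H"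
            and e: "x' \<oplus>\<^bsub>V\<^esub> y' = x \<oplus>\<^bsub>V\<^esub> y" "x \<ominus>\<^bsub>V\<^esub> x0 = x' \<ominus>\<^bsub>V\<^esub> x0"
          have c: "x \<in> carrier V" "y \<in> carrier V" "x0 \<in> carrier V" "y' \<in> carrier V" "x' \<in> carrier V"
            using 0 h GV HV by auto
          have "x = x'" using e(2) c by (metis M.add.inv_closed M.add.right_cancel M.minus_eq)
          then show "x = x' \<and> y = y'" using e(1) c by simp
        qed
        show "(\<lambda>(x, y). x \<ominus>\<^bsub>V\<^esub> x0) ` ?F \<subseteq> G \<inter> H"
        proof clarify
          fix x y assume h: "x \<in> G" "y \<in> H" "z = x \<oplus>\<^bsub>V\<^esub> y"
          then show "x \<ominus>\<^bsub>V\<^esub> x0 \<in> G \<inter> H"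
            using *[OF h(1,2)] minus[OF smc(1) h(1) 0(1)] minus[OF smc(2) 0(2) h(2)] by auto
        qed
      qed
    qed
  qed
  then show ?thesis by (simp add: card_cartesian_product)
qed

section \<open>From library matrices to families of columns\<close>

lemma subspace_mat_iff:
  fixes A :: "'a::field mat set"
  shows "subspace class_ring A (module_mat TYPE('a) m n) \<longleftrightarrow>
    A \<subseteq> carrier_mat m n \<and> 0\<^sub>m m n \<in> A \<and> (\<forall>X\<in>A. \<forall>Y\<in>A. X + Y \<in> A) \<and> (\<forall>c. \<forall>X\<in>A. c \<cdot>\<^sub>m X \<in> A)"
  using matrix_vs[where 'a='a, of m n]
  by (auto simp: subspace_def submodule_def module_mat_simps vectorspace_def)

lemma finite_carrier_mat: "finite (carrier_mat m n :: 'a::finite mat set)"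
proof -
  have "carrier_mat m n \<subseteq> (\<lambda>f. mat m n f) ` (({..<m} \<times> {..<n}) \<rightarrow>\<^sub>E (UNIV :: 'a set))"
  proof
    fix X :: "'a mat" assume "X \<in> carrier_mat m n"
    then have eq: "X = mat m n (restrict (\<lambda>p. X $$ p) ({..<m} \<times> {..<n}))" by (auto intro!: eq_matI)
    show "X \<in> (\<lambda>f. mat m n f) ` (({..<m} \<times> {..<n}) \<rightarrow>\<^sub>E UNIV)" by (subst eq, rule imageI, subst restrict_PiE_iff) simp
  qed
  moreover have "finite (({..<m} \<times> {..<n}) \<rightarrow>\<^sub>E (UNIV :: 'a set))" by (intro finite_PiE) auto
  ultimately show ?thesis by (meson finite_imageI finite_subset)
qed

lemma finite_carrier_vec: "finite (carrier_vec m :: 'a::finite vec set)"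
proof -
  have "carrier_vec m \<subseteq> (\<lambda>f. vec m f) ` ({..<m} \<rightarrow>\<^sub>E (UNIV :: 'a set))"
  proof
    fix x :: "'a vec" assume "x \<in> carrier_vec m"
    then have eq: "x = vec m (restrict (\<lambda>p. x $ p) {..<m})" by auto
    show "x \<in> (\<lambda>f. vec m f) ` ({..<m} \<rightarrow>\<^sub>E UNIV)" by (subst eq, rule imageI, subst restrict_PiE_iff) simp
  qed
  moreover have "finite ({..<m} \<rightarrow>\<^sub>E (UNIV :: 'a set))" by (intro finite_PiE) auto
  ultimately show ?thesis by (meson finite_imageI finite_subset)
qed

text \<open>Vectors of all lengths share one type, which therefore has no single zero. Padding with
  zeros moves them into an abelian group of functions, where the spans of \<open>fn\<close> are
  available.\<close>

definition vec_fun :: "'a vec \<Rightarrow> nat \<Rightarrow> 'a::zero" where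
  "vec_fun x i = (if i < dim_vec x then x $ i else 0)"

text \<open>Column first: \<open>mat_fun X j\<close> is column \<open>j\<close> of \<open>X\<close>.\<close>

definition mat_fun :: "'a mat \<Rightarrow> nat \<Rightarrow> nat \<Rightarrow> 'a::zero" where
  "mat_fun X j i = (if i < dim_row X \<and> j < dim_col X then X $$ (i, j) else 0)"

lemma vec_fun_inj: "inj_on vec_fun (carrier_vec m)"
  by (intro inj_onI eq_vecI) (auto simp: vec_fun_def fun_eq_iff split: if_splits)

lemma mat_fun_inj: "inj_on mat_fun (carrier_mat m n)"
proof (intro inj_onI eq_matI)
  fix X Y :: "'a::zero mat" and i j
  assume *: "X \<in> carrier_mat m n" "Y \<in> carrier_mat m n" "mat_fun X = mat_fun Y"
    "i < dim_row Y" "j < dim_col Y"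
  have "mat_fun X j i = mat_fun Y j i" by (simp only: *(3))
  then show "X $$ (i, j) = Y $$ (i, j)" using *(1,2,4,5) by (simp add: mat_fun_def)
qed auto

text \<open>The link between the two settings: \<open>vec_space.rank\<close> is the dimension of the
  column space in the library sense, and \<open>vec_fun\<close> maps that space bijectively onto the
  span of the padded columns.\<close>

lemma card_span_columns:
  fixes X :: "'a::{field,finite} mat"
  assumes X: "X \<in> carrier_mat m n"
  shows "card (fn.span (mat_fun X ` {..<n})) = CARD('a) ^ vec_space.rank m X"
proof -
  interpret vec_space "TYPE('a)" m .
  let ?W = "span (set (cols X))"
  have cols: "set (cols X) \<subseteq> carrier_vec m" using X cols_dim by blast
  have sub: "submodule class_ring ?W V" using span_is_submodule cols by simp
  have "subspace class_ring ?W V" using span_is_subspace cols by simp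
  moreover have "?W \<subseteq> carrier_vec m" using sub by (auto simp: submodule_def)
  then have finW: "finite ?W" using finite_carrier_vec finite_subset by blast
  ultimately have "card ?W = CARD('a) ^ rank X"
    unfolding rank_def by (rule card_subspace_eq_power_dim)
  have W: "?W \<subseteq> carrier_vec m" by fact
  have img: "vec_fun ` set (cols X) = mat_fun X ` {..<n}"
  proof -
    have "vec_fun (col X j) = mat_fun X j" if "j < n" for j
      using X that by (auto simp: vec_fun_def mat_fun_def fun_eq_iff)
    then have "vec_fun ` col X ` {..<n} = mat_fun X ` {..<n}" by (auto simp: image_image)
    moreover have "set (cols X) = col X ` {..<n}" using X by (auto simp: cols_def)
    ultimately show ?thesis by simp
  qed
  have "vec_fun ` ?W = fn.span (mat_fun X ` {..<n})"
  proof
    let ?P = "{x \<in> carrier_vec m. vec_fun x \<in> fn.span (mat_fun X ` {..<n})}"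
    have add: "vec_fun (x + y) = vec_fun x + vec_fun y"
      and smult: "vec_fun (c \<cdot>\<^sub>v x) = (\<lambda>i. c * vec_fun x i)"
      if "x \<in> carrier_vec m" "y \<in> carrier_vec m" for x y :: "'a vec" and c
      using that by (auto simp: vec_fun_def fun_eq_iff)
    have zero: "vec_fun (0\<^sub>v m :: 'a vec) = 0" by (auto simp: vec_fun_def fun_eq_iff)
    have "submodule class_ring ?P V"
    proof (unfold submodule_def, intro conjI allI impI)
      show "Module.module class_ring V" by (rule module_axioms)
    qed (auto simp: add smult zero module_vec_simps intro: fn.span_add fn.span_scale fn.span_zero)
    moreover have "set (cols X) \<subseteq> ?P" using cols img by (auto intro!: fn.span_base)
    ultimately have "?W \<subseteq> ?P" by (rule span_is_subset[OF _ , rotated])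
    then show "vec_fun ` ?W \<subseteq> fn.span (mat_fun X ` {..<n})" by auto
    show "fn.span (mat_fun X ` {..<n}) \<subseteq> vec_fun ` ?W"
    proof (rule fn.span_minimal)
      show "mat_fun X ` {..<n} \<subseteq> vec_fun ` ?W" 
        unfolding img[symmetric] using in_own_span[of "set (cols X)"] cols by auto
      show "fn.subspace (vec_fun ` ?W)"
        unfolding fn.subspace_def
      proof (intro conjI ballI allI)
        have "0\<^sub>v m \<in> ?W" using sub by (auto simp: submodule_def module_vec_simps)
        then show "0 \<in> vec_fun ` ?W" using zero by (metis image_eqI)
      next
        fix x y assume "x \<in> vec_fun ` ?W" "y \<in> vec_fun ` ?W"
        then obtain x' y' where *: "x' \<in> ?W" "y' \<in> ?W" "x = vec_fun x'" "y = vec_fun y'" by auto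
        then have "x' + y' \<in> ?W" using submodule.m_closed[OF sub *(1,2)] by (simp add: module_vec_simps)
        then show "x + y \<in> vec_fun ` ?W" using * add[of x' y', OF subsetD[OF W] subsetD[OF W]]
            by (intro image_eqI[of _ _ "x' + y'"]) auto
      next
        fix c x assume "x \<in> vec_fun ` ?W"
        then obtain x' where *: "x' \<in> ?W" "x = vec_fun x'" by auto
        then have "c \<cdot>\<^sub>v x' \<in> ?W" using submodule.smult_closed[OF sub _ *(1), of c] by (simp add: module_vec_simps)
        then show "(\<lambda>i. c * x i) \<in> vec_fun ` ?W"
          using * smult[of x' x' c] W by (intro image_eqI[of _ _ "c \<cdot>\<^sub>v x'"]) auto
      qed
    qed
  qed
  then have "card (fn.span (mat_fun X ` {..<n})) = card ?W"
    using card_image[OF inj_on_subset[OF vec_fun_inj W]] by simp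
  then show ?thesis using \<open>card ?W = _\<close> by simp
qed

lemma mat_fun_diff:
  fixes X Y :: "'a::field mat"
  assumes "X \<in> carrier_mat m n" "Y \<in> carrier_mat m n"
  shows "mat_fun (X + (- 1) \<cdot>\<^sub>m Y) = mat_fun X - mat_fun Y"
  using assms by (auto simp: mat_fun_def fun_eq_iff)

lemma mat_fun_smult:
  fixes X :: "'a::field mat"
  shows "mat_fun (c \<cdot>\<^sub>m X) = (\<lambda>j i. c * mat_fun X j i)"
  by (auto simp: mat_fun_def fun_eq_iff)

definition maxrank :: "nat \<Rightarrow> 'a::field mat set \<Rightarrow> nat" where
  "maxrank m A = Max (vec_space.rank m ` A)"

lemma mat_subspace_image:
  fixes A :: "'a::{field,finite} mat set"
  assumes "subspace class_ring A (module_mat TYPE('a) m n)"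
  shows "A \<subseteq> carrier_mat m n" "finite A" "A \<noteq> {}"
    and "\<And>X Y. X \<in> mat_fun ` A \<Longrightarrow> Y \<in> mat_fun ` A \<Longrightarrow> X - Y \<in> mat_fun ` A"
    and "\<And>X c. X \<in> mat_fun ` A \<Longrightarrow> (\<lambda>j i. c * X j i) \<in> mat_fun ` A"
    and "\<And>X j. X \<in> mat_fun ` A \<Longrightarrow> X j \<in> supported_on {..<m}"
    and "\<And>X j. X \<in> mat_fun ` A \<Longrightarrow> n \<le> j \<Longrightarrow> X j = 0"
    and "card (mat_fun ` A) = card A"
proof -
  note A = assms[unfolded subspace_mat_iff]
  show sub: "A \<subseteq> carrier_mat m n" using A by auto
  then show "finite A" using finite_carrier_mat finite_subset by blast
  show "A \<noteq> {}" using A by auto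
  show "X - Y \<in> mat_fun ` A" if XY: "X \<in> mat_fun ` A" "Y \<in> mat_fun ` A" for X Y
  proof -
    obtain X' Y' where *: "X' \<in> A" "X = mat_fun X'" "Y' \<in> A" "Y = mat_fun Y'" using XY by auto
    then have "X' + (- 1) \<cdot>\<^sub>m Y' \<in> A" using A by auto
    then show ?thesis using mat_fun_diff[OF subsetD[OF sub *(1)] subsetD[OF sub *(3)]] *(2,4)
      by (intro image_eqI[of _ _ "X' + (- 1) \<cdot>\<^sub>m Y'"]) auto
  qed
  show "(\<lambda>j i. c * X j i) \<in> mat_fun ` A" if X: "X \<in> mat_fun ` A" for X c
  proof -
    obtain X' where *: "X' \<in> A" "X = mat_fun X'" using X by auto
    then have "c \<cdot>\<^sub>m X' \<in> A" using A by auto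
    then show ?thesis using *(2) mat_fun_smult[of c X']
      by (intro image_eqI[of _ _ "c \<cdot>\<^sub>m X'"]) auto
  qed
  show "X j \<in> supported_on {..<m}" if "X \<in> mat_fun ` A" for X j
    using that sub by (auto simp: mat_fun_def supported_on_def)
  show "X j = 0" if "X \<in> mat_fun ` A" "n \<le> j" for X j
    using that sub by (auto simp: mat_fun_def fun_eq_iff)
  show "card (mat_fun ` A) = card A"
    using card_image[OF inj_on_subset[OF mat_fun_inj sub]] .
qed

lemma card_subspace_le_maxrank:
  fixes A :: "'a::{field,finite} mat set"
  assumes A: "subspace class_ring A (module_mat TYPE('a) m n)" and "n \<le> m"
    and rank: "\<And>X. X \<in> A \<Longrightarrow> vec_space.rank m X \<le> r"
  shows "card A \<le> CARD('a) ^ (m * r)"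
proof -
  note img = mat_subspace_image[OF A]
  have "card (mat_fun ` A) \<le> CARD('a) ^ (m * r)"
  proof (rule matrix_anticode_bound[OF assms(2)])
    fix X assume "X \<in> mat_fun ` A"
    then obtain X' where X': "X' \<in> A" "X = mat_fun X'" by auto
    then have "card (fn.span (X ` {..<n})) = CARD('a) ^ vec_space.rank m X'"
      using card_span_columns img(1) by blast
    also have "\<dots> \<le> CARD('a) ^ r"
      using rank[OF X'(1)] CARD_field_gt_1[where 'a='a] by (intro power_increasing) auto
    finally show "card (fn.span (X ` {..<n})) \<le> CARD('a) ^ r" .
  qed (use img in auto)
  then show ?thesis using img(8) by simp
qed

lemma optimal_anticode_subspace:
  "optimal_anticode m n A \<Longrightarrow> subspace class_ring A (module_mat TYPE('a) m n)"
  for A :: "'a::field mat set"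
  by (simp add: optimal_anticode_def)

lemma rank_le_maxrank:
  fixes A :: "'a::{field,finite} mat set"
  assumes "subspace class_ring A (module_mat TYPE('a) m n)" "X \<in> A"
  shows "vec_space.rank m X \<le> maxrank m A"
  using mat_subspace_image(2)[OF assms(1)] assms(2) by (auto simp: maxrank_def)

lemma card_optimal_anticode:
  fixes A :: "'a::{field,finite} mat set"
  assumes "optimal_anticode m n A"
  shows "card A = CARD('a) ^ (m * maxrank m A)"
  using card_subspace_eq_power_dim[OF optimal_anticode_subspace[OF assms]]
    mat_subspace_image(2)[OF optimal_anticode_subspace[OF assms]] assms
  by (simp add: optimal_anticode_def maxrank_def)

text \<open>A space of matrices of rank at most \<open>r\<close> has at most q^(m r) elements.
  Reaching this size with a smaller maximal rank would contradict the same bound, so the maximal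
  rank is \<open>r\<close> and the anticode is optimal.\<close>

lemma optimal_anticodeI:
  fixes A :: "'a::{field,finite} mat set"
  assumes A: "subspace class_ring A (module_mat TYPE('a) m n)" and "1 \<le> m" "n \<le> m"
    and rank: "\<And>X. X \<in> A \<Longrightarrow> vec_space.rank m X \<le> r"
    and card: "CARD('a) ^ (m * r) \<le> card A"
  shows "optimal_anticode m n A" "maxrank m A = r"
proof -
  note img = mat_subspace_image[OF A]
  have q: "1 < CARD('a)" by (rule CARD_field_gt_1)
  have "CARD('a) ^ (m * r) \<le> CARD('a) ^ (m * maxrank m A)"
    using card card_subspace_le_maxrank[OF A assms(3) rank_le_maxrank[OF A]] by (rule order_trans)
  then have "r \<le> maxrank m A" using q assms(2) power_le_imp_le_exp by fastforce
  moreover have "maxrank m A \<le> r"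
    using img(2,3) rank unfolding maxrank_def by (subst Max_le_iff) auto
  ultimately show r: "maxrank m A = r" by simp
  have "card A = CARD('a) ^ (m * r)"
    using card card_subspace_le_maxrank[OF A assms(3) rank] by simp
  then show "optimal_anticode m n A"
    using card_subspace_eq_power_dim[OF A img(2)] A r q
    by (simp add: optimal_anticode_def maxrank_def[symmetric])
qed

text \<open>Both outcomes of \<open>sub_anticode\<close> cut \<open>A\<close> by a linear condition
  on entries that lowers the rank bound by one and costs at most \<open>m\<close> dimensions. The
  size left is just enough for \<open>optimal_anticodeI\<close>.\<close>

lemma ex_sub_optimal_anticode:
  fixes A :: "'a::{field,finite} mat set"
  assumes oac: "optimal_anticode m n A" and n: "1 \<le> n" "n \<le> m" and u: "maxrank m A = Suc u"
  obtains A' where "A' \<subseteq> A" "optimal_anticode m n A'" "maxrank m A' = u"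
proof -
  let ?q = "CARD('a)"
  have q: "1 < ?q" by (rule CARD_field_gt_1)
  note A = optimal_anticode_subspace[OF oac]
  note img = mat_subspace_image[OF A]
  have span_card: "card (fn.span (mat_fun X ` {..<n})) = ?q ^ vec_space.rank m X" if "X \<in> A" for X
    using card_span_columns img(1) that by blast
  have le: "card (fn.span (X ` {..<n})) \<le> ?q ^ Suc u" if "X \<in> mat_fun ` A" for X
  proof -
    obtain X' where X': "X' \<in> A" "X = mat_fun X'" using \<open>X \<in> mat_fun ` A\<close> by auto
    have "vec_space.rank m X' \<le> Suc u" using rank_le_maxrank[OF A X'(1)] u by simp
    from power_increasing[OF this, of ?q] q show ?thesis
      unfolding X'(2) span_card[OF X'(1)] by simp
  qed
  have cA: "card A = ?q ^ m * ?q ^ (m * u)"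
    using card_optimal_anticode[OF oac] u by (simp add: power_add)
  interpret matrix_anticode m n "Suc u" "mat_fun ` A"
    by unfold_locales (use n img le cA in \<open>auto simp: power_add\<close>)
  have *: "\<exists>A'. A' \<subseteq> A \<and> optimal_anticode m n A' \<and> maxrank m A' = u"
    if sub: "subspace class_ring {X \<in> A. P (mat_fun X)} (module_mat TYPE('a) m n)"
      and card: "card (mat_fun ` A) \<le> ?q ^ m * card {X \<in> mat_fun ` A. P X}"
      and rank: "\<forall>X\<in>{X \<in> mat_fun ` A. P X}. card (fn.span (X ` {..<n})) \<le> ?q ^ (Suc u - 1)" for P
  proof -
    have "{X \<in> mat_fun ` A. P X} = mat_fun ` {X \<in> A. P (mat_fun X)}" by auto
    then have "?q ^ m * ?q ^ (m * u) \<le> ?q ^ m * card {X \<in> A. P (mat_fun X)}"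
      using card img(8) mat_subspace_image(8)[OF sub] cA by simp
    then have "?q ^ (m * u) \<le> card {X \<in> A. P (mat_fun X)}" using q by simp
    moreover have "vec_space.rank m X \<le> u" if "X \<in> {X \<in> A. P (mat_fun X)}" for X
    proof -
      have "?q ^ vec_space.rank m X \<le> ?q ^ u" using rank that span_card[of X] by auto
      then show ?thesis using q power_le_imp_le_exp by blast
    qed
    ultimately show ?thesis using optimal_anticodeI[OF sub _ n(2), of u] n
      by (intro exI[of _ "{X \<in> A. P (mat_fun X)}"]) auto
  qed
  have sub: "subspace class_ring {X \<in> A. \<forall>j\<in>J. \<forall>i\<in>I. mat_fun X j i = 0} (module_mat TYPE('a) m n)" for I J
  proof -
    have zero: "mat_fun (0\<^sub>m m n :: 'a mat) j i = 0" for j i by (simp add: mat_fun_def)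
    have add: "mat_fun (X + Y) j i = mat_fun X j i + mat_fun Y j i" if "X \<in> A" "Y \<in> A" for X Y j i
      using subsetD[OF img(1) that(1)] subsetD[OF img(1) that(2)] by (auto simp: mat_fun_def)
    show ?thesis
      using A unfolding subspace_mat_iff by (auto simp: mat_fun_smult zero add)
  qed
  show ?thesis
    using sub_anticode
  proof (elim disjE exE conjE)
    fix j assume "j < n" "card (mat_fun ` A) \<le> ?q ^ m * card {X \<in> mat_fun ` A. X j = 0}"
      "\<forall>X\<in>{X \<in> mat_fun ` A. X j = 0}. card (fn.span (X ` {..<n})) \<le> ?q ^ (Suc u - 1)"
    moreover have "subspace class_ring {X \<in> A. mat_fun X j = 0} (module_mat TYPE('a) m n)"
      using sub[of "{j}" UNIV] by (simp add: fun_eq_iff)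
    ultimately show ?thesis using *[of "\<lambda>X. X j = 0"] that by blast
  next
    fix i assume "i < m" "card (mat_fun ` A) \<le> ?q ^ m * card {X \<in> mat_fun ` A. \<forall>j<n. X j i = 0}"
      "\<forall>X\<in>{X \<in> mat_fun ` A. \<forall>j<n. X j i = 0}. card (fn.span (X ` {..<n})) \<le> ?q ^ (Suc u - 1)"
    moreover have "subspace class_ring {X \<in> A. \<forall>j<n. mat_fun X j i = 0} (module_mat TYPE('a) m n)"
      using sub[of "{..<n}" "{i}"] by (simp add: Ball_def)
    ultimately show ?thesis using *[of "\<lambda>X. \<forall>j<n. X j i = 0"] that by blast
  qed
qed

definition column_anticode :: "nat \<Rightarrow> nat \<Rightarrow> nat \<Rightarrow> 'a::field mat set" where
  "column_anticode m n u = {X \<in> carrier_mat m n. \<forall>i<m. \<forall>j<n. u \<le> j \<longrightarrow> X $$ (i, j) = 0}"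

lemma optimal_anticode_column_anticode:
  assumes "1 \<le> m" "n \<le> m" "u \<le> n"
  shows "optimal_anticode m n (column_anticode m n u :: 'a::{field,finite} mat set)"
    and "maxrank m (column_anticode m n u :: 'a mat set) = u"
proof -
  let ?A = "column_anticode m n u :: 'a mat set" and ?q = "CARD('a)"
  have q: "1 < ?q" by (rule CARD_field_gt_1)
  have A: "subspace class_ring ?A (module_mat TYPE('a) m n)"
    unfolding subspace_mat_iff column_anticode_def by auto
  have rank: "vec_space.rank m X \<le> u" if X: "X \<in> ?A" for X
  proof -
    have "X \<in> carrier_mat m n" using X by (simp add: column_anticode_def)
    then have "?q ^ vec_space.rank m X = card (fn.span (mat_fun X ` {..<n}))"
      using card_span_columns by metis
    also have "fn.span (mat_fun X ` {..<n}) \<subseteq> fn.span (mat_fun X ` {..<u})"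
    proof (intro fn.span_minimal fn.subspace_span subsetI)
      fix x assume "x \<in> mat_fun X ` {..<n}"
      then obtain j where j: "j < n" "x = mat_fun X j" by auto
      show "x \<in> fn.span (mat_fun X ` {..<u})"
      proof (cases "j < u")
        case True
        then show ?thesis using j by (auto intro: fn.span_base)
      next
        case False
        then have "x = 0" using j X by (auto simp: column_anticode_def mat_fun_def fun_eq_iff)
        then show ?thesis by (simp add: fn.span_zero)
      qed
    qed
    then have "card (fn.span (mat_fun X ` {..<n})) \<le> card (fn.span (mat_fun X ` {..<u}))"
      by (intro card_mono fn.finite_span) auto
    also have "\<dots> \<le> ?q ^ card (mat_fun X ` {..<u})" by (rule fn.card_span_le) simp
    also have "\<dots> \<le> ?q ^ u"
      using card_image_le[of "{..<u}" "mat_fun X"] q by (intro power_increasing) auto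
    finally show ?thesis using q power_le_imp_le_exp by blast
  qed
  \<comment> \<open>The \<open>m * u\<close> entries in the first \<open>u\<close> columns can be
    chosen freely.\<close>
  have "?q ^ (m * u) = card (({..<m} \<times> {..<u}) \<rightarrow>\<^sub>E (UNIV :: 'a set))"
    by (simp add: card_PiE card_cartesian_product)
  also have "\<dots> \<le> card ?A"
  proof (rule card_inj_on_le)
    let ?f = "\<lambda>f. mat m n (\<lambda>(i, j). if j < u then f (i, j) else 0)"
    show "inj_on ?f (({..<m} \<times> {..<u}) \<rightarrow>\<^sub>E (UNIV :: 'a set))"
    proof (rule inj_onI)
      fix f g assume fg: "f \<in> ({..<m} \<times> {..<u}) \<rightarrow>\<^sub>E (UNIV :: 'a set)" "g \<in> ({..<m} \<times> {..<u}) \<rightarrow>\<^sub>E UNIV"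
        and eq: "?f f = ?f g"
      have "f (i, j) = g (i, j)" if "i < m" "j < u" for i j
        using arg_cong[OF eq, of "\<lambda>X. X $$ (i, j)"] that assms(3) by simp
      then show "f = g" using fg by (intro PiE_ext[OF fg]) auto
    qed
    show "?f ` (({..<m} \<times> {..<u}) \<rightarrow>\<^sub>E UNIV) \<subseteq> ?A" by (auto simp: column_anticode_def)
    show "finite ?A" using mat_subspace_image(2)[OF A] .
  qed
  finally show "optimal_anticode m n ?A" "maxrank m ?A = u"
    using optimal_anticodeI[OF A assms(1,2) rank] by auto
qed

section \<open>Adjoining a vector to a subspace\<close>

lemma subspace_Int:
  assumes "subspace K G V" "subspace K H V"
  shows "subspace K (G \<inter> H) V"
  using assms by (auto simp: subspace_def submodule_def)

lemma subspace_adjoin: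
  fixes V :: "('a::{field,finite}, 'v, 'z) module_scheme"
  defines "adjoin W x \<equiv> (\<lambda>(c, w). w \<oplus>\<^bsub>V\<^esub> c \<odot>\<^bsub>V\<^esub> x) ` ((UNIV :: 'a set) \<times> W)"
  assumes W: "subspace class_ring W V" and x: "x \<in> carrier V" "x \<notin> W"
  shows "subspace class_ring (adjoin W x) V" "W \<subseteq> adjoin W x" "x \<in> adjoin W x"
    and "card (adjoin W x) = CARD('a) * card W"
proof -
  have "vectorspace class_ring V" using W by (simp add: subspace_def)
  then interpret vectorspace class_ring V .
  have sm: "submodule class_ring W V" using W by (simp add: subspace_def)
  have WV: "w \<in> carrier V" if "w \<in> W" for w using sm that by (auto simp: submodule_def)
  have smx: "c \<odot>\<^bsub>V\<^esub> x \<in> carrier V" for c using x(1) by (intro smult_closed) auto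
  have add: "w \<oplus>\<^bsub>V\<^esub> w' \<in> W" if "w \<in> W" "w' \<in> W" for w w'
    using sm that by (auto simp: submodule_def)
  have scale: "c \<odot>\<^bsub>V\<^esub> w \<in> W" if "w \<in> W" for c w
    using sm that by (auto simp: submodule_def)
  have zero: "\<zero>\<^bsub>V\<^esub> \<in> W" using sm by (auto simp: submodule_def)
  have l_distr: "(c + d) \<odot>\<^bsub>V\<^esub> y = c \<odot>\<^bsub>V\<^esub> y \<oplus>\<^bsub>V\<^esub> d \<odot>\<^bsub>V\<^esub> y" if "y \<in> carrier V" for c d y
    using smult_l_distr[of c d y] that by simp
  have r_distr: "c \<odot>\<^bsub>V\<^esub> (y \<oplus>\<^bsub>V\<^esub> z) = c \<odot>\<^bsub>V\<^esub> y \<oplus>\<^bsub>V\<^esub> c \<odot>\<^bsub>V\<^esub> z"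
    if "y \<in> carrier V" "z \<in> carrier V" for c y z
    using smult_r_distr[of c y z] that by simp
  have assoc: "(c * d) \<odot>\<^bsub>V\<^esub> y = c \<odot>\<^bsub>V\<^esub> (d \<odot>\<^bsub>V\<^esub> y)" if "y \<in> carrier V" for c d y
    using smult_assoc1[of c d y] that by simp
  have one: "1 \<odot>\<^bsub>V\<^esub> y = y" if "y \<in> carrier V" for y using smult_one[of y] that by simp
  have null: "0 \<odot>\<^bsub>V\<^esub> y = \<zero>\<^bsub>V\<^esub>" if "y \<in> carrier V" for y using lmult_0[of y] that by simp
  show sub: "W \<subseteq> adjoin W x"
  proof
    fix w assume "w \<in> W"
    then show "w \<in> adjoin W x"
      unfolding adjoin_def using null[OF x(1)] WV by (intro image_eqI[of _ _ "(0, w)"]) auto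
  qed
  show "x \<in> adjoin W x"
    unfolding adjoin_def using one[OF x(1)] zero x(1) by (intro image_eqI[of _ _ "(1, \<zero>\<^bsub>V\<^esub>)"]) auto
  show "subspace class_ring (adjoin W x) V"
  proof (intro subspace.intro submodule.intro)
    show "vectorspace class_ring V" by unfold_locales
    show "Module.module class_ring V" by unfold_locales
    show "adjoin W x \<subseteq> carrier V" unfolding adjoin_def using WV smx by auto
    show "\<zero>\<^bsub>V\<^esub> \<in> adjoin W x" using sub zero by auto
  next
    fix y z assume "y \<in> adjoin W x" "z \<in> adjoin W x"
    then obtain c w d w' where e: "w \<in> W" "w' \<in> W" "y = w \<oplus>\<^bsub>V\<^esub> c \<odot>\<^bsub>V\<^esub> x" "z = w' \<oplus>\<^bsub>V\<^esub> d \<odot>\<^bsub>V\<^esub> x"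
      unfolding adjoin_def by auto
    have "y \<oplus>\<^bsub>V\<^esub> z = (w \<oplus>\<^bsub>V\<^esub> w') \<oplus>\<^bsub>V\<^esub> (c + d) \<odot>\<^bsub>V\<^esub> x"
      unfolding e l_distr[OF x(1)] using smx WV[OF e(1)] WV[OF e(2)]
      by (simp add: M.a_ac)
    then show "y \<oplus>\<^bsub>V\<^esub> z \<in> adjoin W x"
      unfolding adjoin_def using add[OF e(1,2)] by (intro image_eqI[of _ _ "(c + d, w \<oplus>\<^bsub>V\<^esub> w')"]) auto
  next
    fix c y assume "y \<in> adjoin W x"
    then obtain d w where e: "w \<in> W" "y = w \<oplus>\<^bsub>V\<^esub> d \<odot>\<^bsub>V\<^esub> x" unfolding adjoin_def by auto
    have "c \<odot>\<^bsub>V\<^esub> y = c \<odot>\<^bsub>V\<^esub> w \<oplus>\<^bsub>V\<^esub> (c * d) \<odot>\<^bsub>V\<^esub> x"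
      unfolding e assoc[OF x(1)] using r_distr[OF WV[OF e(1)] smx] .
    then show "c \<odot>\<^bsub>V\<^esub> y \<in> adjoin W x"
      unfolding adjoin_def using scale[OF e(1)] by (intro image_eqI[of _ _ "(c * d, c \<odot>\<^bsub>V\<^esub> w)"]) auto
  qed
  have "inj_on (\<lambda>(c, w). w \<oplus>\<^bsub>V\<^esub> c \<odot>\<^bsub>V\<^esub> x) ((UNIV :: 'a set) \<times> W)"
  proof (rule inj_onI, clarify)
    fix c w d w' assume w: "w \<in> W" "w' \<in> W" and eq: "w \<oplus>\<^bsub>V\<^esub> c \<odot>\<^bsub>V\<^esub> x = w' \<oplus>\<^bsub>V\<^esub> d \<odot>\<^bsub>V\<^esub> x"
    have cd: "c = d"
    proof (rule ccontr)
      assume "c \<noteq> d"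
      have "c \<odot>\<^bsub>V\<^esub> x = (d + (c - d)) \<odot>\<^bsub>V\<^esub> x" by simp
      also have "\<dots> = d \<odot>\<^bsub>V\<^esub> x \<oplus>\<^bsub>V\<^esub> (c - d) \<odot>\<^bsub>V\<^esub> x" by (rule l_distr[OF x(1)])
      finally have "w \<oplus>\<^bsub>V\<^esub> (d \<odot>\<^bsub>V\<^esub> x \<oplus>\<^bsub>V\<^esub> (c - d) \<odot>\<^bsub>V\<^esub> x) = w' \<oplus>\<^bsub>V\<^esub> d \<odot>\<^bsub>V\<^esub> x" using eq by simp
      then have "(w \<oplus>\<^bsub>V\<^esub> (c - d) \<odot>\<^bsub>V\<^esub> x) \<oplus>\<^bsub>V\<^esub> d \<odot>\<^bsub>V\<^esub> x = w' \<oplus>\<^bsub>V\<^esub> d \<odot>\<^bsub>V\<^esub> x"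
        using WV[OF w(1)] smx by (simp add: M.a_ac)
      then have e: "w \<oplus>\<^bsub>V\<^esub> (c - d) \<odot>\<^bsub>V\<^esub> x = w'"
        using WV[OF w(1)] WV[OF w(2)] smx by simp
      have m: "(- 1) \<odot>\<^bsub>V\<^esub> w \<oplus>\<^bsub>V\<^esub> w = \<zero>\<^bsub>V\<^esub>"
        using l_distr[OF WV[OF w(1)], of "- 1" 1] one null WV[OF w(1)] by simp
      have mW: "(- 1) \<odot>\<^bsub>V\<^esub> w \<in> W" using scale w(1) .
      have "(- 1) \<odot>\<^bsub>V\<^esub> w \<oplus>\<^bsub>V\<^esub> w' = (- 1) \<odot>\<^bsub>V\<^esub> w \<oplus>\<^bsub>V\<^esub> w \<oplus>\<^bsub>V\<^esub> (c - d) \<odot>\<^bsub>V\<^esub> x"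
        using WV[OF w(1)] WV[OF mW] smx by (simp add: M.a_assoc e[symmetric])
      then have "(c - d) \<odot>\<^bsub>V\<^esub> x = (- 1) \<odot>\<^bsub>V\<^esub> w \<oplus>\<^bsub>V\<^esub> w'" using m smx by simp
      then have "(c - d) \<odot>\<^bsub>V\<^esub> x \<in> W" using add[OF mW w(2)] by simp
      from scale[OF this, of "inverse (c - d)"] have "x \<in> W"
        using \<open>c \<noteq> d\<close> x(1) by (simp add: assoc[symmetric] one)
      then show False using x(2) by simp
    qed
    then show "c = d \<and> w = w'" using eq WV[OF w(1)] WV[OF w(2)] smx by simp
  qed
  then show "card (adjoin W x) = CARD('a) * card W"
    unfolding adjoin_def by (simp add: card_image card_cartesian_product)
qed

text \<open>For \<open>x \<in> D\<close>, adjoining \<open>x\<close> to \<open>W \<inter> D\<close>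
  stays inside \<open>W' \<inter> D\<close>, so the intersection also gains a dimension. This lets
  one new vector raise several intersection dimensions simultaneously.\<close>

lemma ex_adjoin:
  fixes V :: "('a::{field,finite}, 'v, 'z) module_scheme"
  assumes W: "subspace class_ring W V" and x: "x \<in> carrier V" "x \<notin> W"
  obtains W' where "subspace class_ring W' V" "W \<subseteq> W'" "card W' = CARD('a) * card W"
    and "\<And>D. subspace class_ring D V \<Longrightarrow> finite (W' \<inter> D) \<Longrightarrow> x \<in> D \<Longrightarrow>
          CARD('a) * card (W \<inter> D) \<le> card (W' \<inter> D)"
    and "\<And>D. subspace class_ring D V \<Longrightarrow> W \<subseteq> D \<Longrightarrow> x \<in> D \<Longrightarrow> W' \<subseteq> D"
proof -
  define adjoin where "adjoin W = (\<lambda>(c, w). w \<oplus>\<^bsub>V\<^esub> c \<odot>\<^bsub>V\<^esub> x) ` ((UNIV :: 'a set) \<times> W)" for W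
  note adj = subspace_adjoin[of _ V x, folded adjoin_def, OF _ x(1)]
  have min: "adjoin W' \<subseteq> D" if "subspace class_ring D V" "W' \<subseteq> D" "x \<in> D" for D W'
  proof -
    have "submodule class_ring D V" using that(1) by (simp add: subspace_def)
    then show ?thesis using that(2,3) unfolding adjoin_def submodule_def by auto
  qed
  show thesis
  proof (rule that[of "adjoin W"])
    fix D assume D: "subspace class_ring D V" "finite (adjoin W \<inter> D)" "x \<in> D"
    note WD = subspace_Int[OF W D(1)]
    have "adjoin (W \<inter> D) \<subseteq> adjoin W \<inter> D"
      using min[OF D(1) _ D(3), of "W \<inter> D"] by (auto simp: adjoin_def)
    from card_mono[OF D(2) this] show "CARD('a) * card (W \<inter> D) \<le> card (adjoin W \<inter> D)"
      using adj(4)[OF WD] x(2) by simp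
  qed (use adj[OF W x(2)] min in auto)
qed

text \<open>For sorted lists, inclusion of multisets suffices, so comparing generalized weights
  reduces to comparing multiplicities. If the heads differ, the head of \<open>ys\<close> is smaller
  than everything in \<open>xs\<close> and can be skipped.\<close>

lemma subseq_if_sorted_count_le:
  assumes "sorted xs" "sorted ys" "\<And>x. count_list xs x \<le> count_list ys x"
  shows "subseq xs (ys :: 'b::linorder list)"
  using assms
proof (induction ys arbitrary: xs)
  case Nil
  from Nil(3)[of "hd xs"] show ?case by (cases xs) auto
next
  case (Cons y ys)
  show ?case
  proof (cases xs)
    case Nil
    then show ?thesis by simp
  next
    case xs: (Cons x xs')
    show ?thesis
    proof (cases "x = y")
      case True
      have "count_list xs' z \<le> count_list ys z" for z
        using Cons.prems(3)[of z] by (simp add: xs True split: if_splits)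
      then show ?thesis using Cons.IH[of xs'] Cons.prems(1,2) by (simp add: xs True)
    next
      case False
      have "x \<in> set (y # ys)"
        using Cons.prems(3)[of x] by (intro ccontr[of "x \<in> set (y # ys)"]) (auto simp: xs count_list_0_iff)
      then have "y < x" using False Cons.prems(2) by auto
      then have "y \<notin> set xs" using Cons.prems(1) by (auto simp: xs)
      then have "count_list xs z \<le> count_list ys z" for z
        using Cons.prems(3)[of z] by (cases "z = y") (auto simp: count_list_0_iff)
      then have "subseq xs ys" using Cons.IH Cons.prems(1,2) by simp
      then show ?thesis by (rule list_emb_Cons)
    qed
  qed
qed

lemma sorted_if_subseq: "subseq xs ys \<Longrightarrow> sorted ys \<Longrightarrow> sorted xs"
  by (induction rule: list_emb.induct) (auto dest: list_emb_set)

lemma count_list_le_if_subseq: "subseq xs ys \<Longrightarrow> count_list xs x \<le> count_list ys x"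
  by (induction rule: list_emb.induct) auto

section \<open>Weights of codes\<close>

text \<open>The parameter \<open>ty\<close> carries the field, which the types of \<open>t\<close>,
  \<open>m\<close> and \<open>n\<close> do not mention.\<close>

locale sum_rank_space =
  fixes ty :: "'a::{field,finite} itself" and t :: nat and m n :: "nat \<Rightarrow> nat"
  assumes n_bounds: "\<And>i. i \<in> {1..t} \<Longrightarrow> 1 \<le> n i \<and> n i \<le> m i"
    and m_antimono: "\<And>i j. 1 \<le> i \<Longrightarrow> i \<le> j \<Longrightarrow> j \<le> t \<Longrightarrow> m j \<le> m i"
begin

abbreviation M :: "('a, nat \<Rightarrow> 'a mat) module" where "M \<equiv> sr_space t m n"

abbreviation code :: "(nat \<Rightarrow> 'a mat) set \<Rightarrow> bool" where "code \<equiv> sr_code t m n"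

abbreviation dimension :: "(nat \<Rightarrow> 'a mat) set \<Rightarrow> nat" where "dimension \<equiv> code_dim t m n"

abbreviation weight :: "(nat \<Rightarrow> 'a mat) set \<Rightarrow> nat" where "weight \<equiv> code_wt t m n"

lemma code_iff:
  "code C \<longleftrightarrow> C \<subseteq> carrier M \<and> \<zero>\<^bsub>M\<^esub> \<in> C \<and>
     (\<forall>X\<in>C. \<forall>Y\<in>C. (\<lambda>i\<in>{1..t}. X i + Y i) \<in> C) \<and> (\<forall>c. \<forall>X\<in>C. (\<lambda>i\<in>{1..t}. c \<cdot>\<^sub>m X i) \<in> C)"
  using vectorspace_sr_space[of t m n, where 'a='a]
  by (auto simp: subspace_def submodule_def vectorspace_def sr_space_simps)

lemma finite_M: "finite (carrier M)"
  unfolding sr_space_simps by (intro finite_PiE finite_carrier_mat) auto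

lemma code_subset: "code C \<Longrightarrow> C \<subseteq> carrier M"
  by (simp add: code_iff)

lemma zero_in_code: "code C \<Longrightarrow> \<zero>\<^bsub>M\<^esub> \<in> C"
  by (simp add: code_iff)

lemma finite_code: "code C \<Longrightarrow> finite C"
  using code_subset finite_M finite_subset by blast

lemma card_code: "code C \<Longrightarrow> card C = CARD('a) ^ dimension C"
  using card_subspace_eq_power_dim[OF _ finite_code, of C M] by (simp add: code_dim_def)

lemma q_gt_1: "1 < CARD('a)"
  by (rule CARD_field_gt_1)

lemma dimension_eqI: "code C \<Longrightarrow> card C = CARD('a) ^ k \<Longrightarrow> dimension C = k"
  using card_code q_gt_1 by simp

lemma le_dimensionI: "code C \<Longrightarrow> CARD('a) ^ k \<le> card C \<Longrightarrow> k \<le> dimension C"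
  using card_code q_gt_1 by simp

lemma dimension_mono: "code C \<Longrightarrow> code D \<Longrightarrow> C \<subseteq> D \<Longrightarrow> dimension C \<le> dimension D"
  using card_mono[OF finite_code, of D C] card_code by (intro le_dimensionI) auto

lemma dimension_Int:
  assumes "code G" "code H" "code K" "G \<subseteq> K" "H \<subseteq> K"
  shows "dimension G + dimension H \<le> dimension K + dimension (G \<inter> H)"
proof -
  have "CARD('a) ^ (dimension G + dimension H) = card G * card H"
    using assms card_code by (simp add: power_add)
  also have "\<dots> \<le> card K * card (G \<inter> H)"
    using assms finite_code by (intro card_subspaces_Int)
  also have "\<dots> = CARD('a) ^ (dimension K + dimension (G \<inter> H))"
    using assms card_code subspace_Int[OF assms(1,2)] by (simp add: power_add)
  finally show ?thesis using q_gt_1 by simp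
qed

lemma code_M: "code (carrier M)"
proof -
  interpret vectorspace class_ring M by (rule vectorspace_sr_space)
  show ?thesis
    by (intro subspace.intro submodule.intro) (auto intro: vectorspace_axioms module_axioms smult_closed)
qed

section \<open>Products of optimal anticodes and the weight\<close>

definition anticodes :: "(nat \<Rightarrow> 'a mat set) \<Rightarrow> bool" where
  "anticodes A \<longleftrightarrow> (\<forall>i\<in>{1..t}. optimal_anticode (m i) (n i) (A i))"

definition total_rank :: "(nat \<Rightarrow> 'a mat set) \<Rightarrow> nat" where
  "total_rank A = (\<Sum>i=1..t. maxrank (m i) (A i))"

lemma anticode_mat_subspace:
  "anticodes A \<Longrightarrow> i \<in> {1..t} \<Longrightarrow> subspace class_ring (A i) (module_mat TYPE('a) (m i) (n i))"
  by (simp add: anticodes_def optimal_anticode_subspace)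

lemma code_anticodes:
  assumes A: "anticodes A"
  shows "code (Pi\<^sub>E {1..t} A)"
proof -
  have *: "A i \<subseteq> carrier_mat (m i) (n i)" "0\<^sub>m (m i) (n i) \<in> A i"
    "\<And>X Y. X \<in> A i \<Longrightarrow> Y \<in> A i \<Longrightarrow> X + Y \<in> A i" "\<And>X c. X \<in> A i \<Longrightarrow> c \<cdot>\<^sub>m X \<in> A i"
    if "i \<in> {1..t}" for i
    using anticode_mat_subspace[OF A that] by (auto simp: subspace_mat_iff)
  have "Pi\<^sub>E {1..t} A \<subseteq> carrier M" unfolding sr_space_simps using *(1) by (intro PiE_mono) auto
  then show ?thesis
    unfolding code_iff by (auto simp: sr_space_simps(2) PiE_iff * )
qed

lemma dimension_anticodes:
  assumes A: "anticodes A"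
  shows "dimension (Pi\<^sub>E {1..t} A) = (\<Sum>i=1..t. m i * maxrank (m i) (A i))"
proof (rule dimension_eqI[OF code_anticodes[OF A]])
  show "card (Pi\<^sub>E {1..t} A) = CARD('a) ^ (\<Sum>i=1..t. m i * maxrank (m i) (A i))"
    using A by (auto simp: card_PiE card_optimal_anticode anticodes_def power_sum intro!: prod.cong)
qed

lemma maxsrk_anticodes:
  assumes A: "anticodes A"
  shows "maxsrk t m (Pi\<^sub>E {1..t} A) = total_rank A"
  unfolding maxsrk_def
proof (rule Max_eqI)
  show "finite (srk t m ` Pi\<^sub>E {1..t} A)" using finite_code[OF code_anticodes[OF A]] by simp
  show "x \<le> total_rank A" if "x \<in> srk t m ` Pi\<^sub>E {1..t} A" for x
  proof -
    obtain X where X: "X \<in> Pi\<^sub>E {1..t} A" "x = srk t m X" using \<open>x \<in> _\<close> by auto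
    show ?thesis unfolding X(2) srk_def total_rank_def
      using rank_le_maxrank[OF anticode_mat_subspace[OF A] PiE_mem[OF X(1)]] by (intro sum_mono)
  qed
  have "\<forall>i\<in>{1..t}. \<exists>X\<in>A i. vec_space.rank (m i) X = maxrank (m i) (A i)"
  proof
    fix i assume "i \<in> {1..t}"
    note img = mat_subspace_image[OF anticode_mat_subspace[OF A this]]
    have "maxrank (m i) (A i) \<in> vec_space.rank (m i) ` A i"
      unfolding maxrank_def using img(2,3) by (intro Max_in) auto
    then show "\<exists>X\<in>A i. vec_space.rank (m i) X = maxrank (m i) (A i)" by auto
  qed
  then obtain X where X: "\<forall>i\<in>{1..t}. X i \<in> A i \<and> vec_space.rank (m i) (X i) = maxrank (m i) (A i)"
    unfolding bchoice_iff by (metis (no_types, lifting))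
  show "total_rank A \<in> srk t m ` Pi\<^sub>E {1..t} A"
    using X by (intro image_eqI[of _ _ "restrict X {1..t}"])
      (auto simp: total_rank_def srk_def intro!: sum.cong)
qed

lemma total_rank_le:
  assumes "anticodes A"
  shows "total_rank A \<le> (\<Sum>i=1..t. n i)" "\<And>i. i \<in> {1..t} \<Longrightarrow> maxrank (m i) (A i) \<le> n i"
proof -
  show le: "maxrank (m i) (A i) \<le> n i" if i: "i \<in> {1..t}" for i
  proof -
    note img = mat_subspace_image[OF anticode_mat_subspace[OF assms i]]
    show ?thesis
      unfolding maxrank_def using img(1,2,3) vec_space.rank_le_nc by (subst Max_le_iff) blast+
  qed
  show "total_rank A \<le> (\<Sum>i=1..t. n i)" unfolding total_rank_def using le by (intro sum_mono) auto
qed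

lemma weight_eq: "weight C = Min {total_rank A | A. anticodes A \<and> C \<subseteq> Pi\<^sub>E {1..t} A}"
proof -
  have "{maxsrk t m (Pi\<^sub>E {1..t} A) | A.
     (\<forall>i\<in>{1..t}. optimal_anticode (m i) (n i) (A i)) \<and> C \<subseteq> Pi\<^sub>E {1..t} A}
    = {total_rank A | A. anticodes A \<and> C \<subseteq> Pi\<^sub>E {1..t} A}"
    using maxsrk_anticodes unfolding anticodes_def[symmetric] by metis
  then show ?thesis unfolding code_wt_def by simp
qed

lemma finite_total_ranks: "finite {total_rank A | A. anticodes A \<and> C \<subseteq> Pi\<^sub>E {1..t} A}"
proof (rule finite_subset)
  show "{total_rank A | A. anticodes A \<and> C \<subseteq> Pi\<^sub>E {1..t} A} \<subseteq> {..\<Sum>i=1..t. n i}"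
    using total_rank_le(1) by blast
qed simp

lemma weight_le: "anticodes A \<Longrightarrow> C \<subseteq> Pi\<^sub>E {1..t} A \<Longrightarrow> weight C \<le> total_rank A"
  unfolding weight_eq using finite_total_ranks by (intro Min_le) auto

lemma weight_attained:
  assumes "C \<subseteq> carrier M"
  obtains A where "anticodes A" "C \<subseteq> Pi\<^sub>E {1..t} A" "weight C = total_rank A"
proof -
  \<comment> \<open>The full matrix spaces are themselves optimal anticodes, so the minimum is taken
    over a nonempty set.\<close>
  let ?A = "\<lambda>i. column_anticode (m i) (n i) (n i) :: 'a mat set"
  have "anticodes ?A" unfolding anticodes_def
  proof
    fix i assume "i \<in> {1..t}"
    from n_bounds[OF this] show "optimal_anticode (m i) (n i) (?A i)"
      by (intro optimal_anticode_column_anticode(1)) auto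
  qed
  moreover have "column_anticode k l l = (carrier_mat k l :: 'a mat set)" for k l
    by (auto simp: column_anticode_def)
  then have "C \<subseteq> Pi\<^sub>E {1..t} ?A" using assms by (simp add: sr_space_simps)
  ultimately have "{total_rank A | A. anticodes A \<and> C \<subseteq> Pi\<^sub>E {1..t} A} \<noteq> {}" by blast
  from Min_in[OF finite_total_ranks this] show thesis using that unfolding weight_eq[symmetric] by blast
qed

lemma weight_le_n: "C \<subseteq> carrier M \<Longrightarrow> weight C \<le> (\<Sum>i=1..t. n i)"
  using weight_attained total_rank_le(1) by metis

lemma srk_le_weight:
  assumes "C \<subseteq> carrier M" "X \<in> C"
  shows "srk t m X \<le> weight C"
proof -
  obtain A where A: "anticodes A" "C \<subseteq> Pi\<^sub>E {1..t} A" "weight C = total_rank A"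
    using weight_attained[OF assms(1)] .
  have "srk t m X \<le> maxsrk t m (Pi\<^sub>E {1..t} A)"
    unfolding maxsrk_def using finite_code[OF code_anticodes[OF A(1)]] A(2) assms(2) by (intro Max_ge) auto
  then show ?thesis using A maxsrk_anticodes by simp
qed

text \<open>The columns of all blocks are numbered consecutively from \<open>1\<close>.\<close>

definition ncols :: "nat \<Rightarrow> nat" where "ncols j = (\<Sum>i=1..j. n i)"

definition block :: "nat \<Rightarrow> nat" where "block p = (LEAST j. p \<le> ncols j)"

definition mu :: "nat \<Rightarrow> nat" where "mu p = m (block p)"

lemma ncols_mono: "i \<le> j \<Longrightarrow> ncols i \<le> ncols j"
  unfolding ncols_def by (intro sum_mono2) auto

lemma ncols_Suc: "ncols (Suc j) = ncols j + n (Suc j)"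
  by (simp add: ncols_def)

lemma block:
  assumes "1 \<le> p" "p \<le> ncols t"
  shows "block p \<in> {1..t}" "ncols (block p - 1) < p" "p \<le> ncols (block p)"
proof -
  show le: "p \<le> ncols (block p)" unfolding block_def using assms(2) by (rule LeastI)
  have "block p \<noteq> 0" using le assms(1) by (intro notI) (simp add: ncols_def)
  moreover have "block p \<le> t" unfolding block_def using assms(2) by (rule Least_le)
  ultimately show "block p \<in> {1..t}" by auto
  have "block p - 1 < block p" using \<open>block p \<noteq> 0\<close> by simp
  from not_less_Least[OF this[unfolded block_def]] show "ncols (block p - 1) < p" by (simp add: block_def)
qed

lemma block_eqI:
  assumes "1 \<le> j" "ncols (j - 1) < p" "p \<le> ncols j"
  shows "block p = j"
  unfolding block_def
proof (rule Least_equality)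
  show "j \<le> i" if "p \<le> ncols i" for i
  proof (rule ccontr)
    assume "\<not> j \<le> i"
    then have "ncols i \<le> ncols (j - 1)" by (intro ncols_mono) simp
    then show False using that assms(2) by simp
  qed
qed fact

definition filled :: "nat \<Rightarrow> nat \<Rightarrow> nat" where
  "filled p i = card {p' \<in> {1..p}. block p' = i}"

lemma filled_Suc: "filled (Suc p) i = filled p i + (if block (Suc p) = i then 1 else 0)"
proof -
  have "{p' \<in> {1..Suc p}. block p' = i}
      = (if block (Suc p) = i then insert (Suc p) {p' \<in> {1..p}. block p' = i} else {p' \<in> {1..p}. block p' = i})"
    by (auto simp: le_Suc_eq)
  then show ?thesis by (auto simp: filled_def)
qed

lemma filled_le:
  assumes "i \<in> {1..t}" "p \<le> ncols t"
  shows "filled p i \<le> n i"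
proof -
  have "{p' \<in> {1..p}. block p' = i} \<subseteq> {ncols (i - 1)<..ncols i}"
    using assms(2) block(2,3) by auto
  from card_mono[OF _ this] show ?thesis
    using assms(1) ncols_Suc[of "i - 1"] by (simp add: filled_def)
qed

lemma filled_mono: "p \<le> p' \<Longrightarrow> filled p i \<le> filled p' i"
  unfolding filled_def by (intro card_mono) auto

lemma sum_filled:
  assumes "p \<le> ncols t"
  shows "(\<Sum>i=1..t. filled p i) = p" "(\<Sum>i=1..t. m i * filled p i) = (\<Sum>p'=1..p. mu p')"
  using assms
proof (induction p)
  case 0
  { case 1 show ?case by (simp add: filled_def) }
  { case 2 show ?case by (simp add: filled_def) }
next
  case (Suc p)
  { case 1
    then show ?case using Suc(1) block(1)[of "Suc p"]
      by (simp add: filled_Suc sum.distrib) }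
  { case 2
    have "m i * (if block (Suc p) = i then 1 else 0) = (if block (Suc p) = i then mu (Suc p) else 0)" for i
      by (simp add: mu_def)
    then show ?case using 2 Suc(2) block(1)[of "Suc p"]
      by (simp add: filled_Suc sum.distrib distrib_left) }
qed

text \<open>This is the space called \<open>A p\<close> in the overview. It is a product of optimal
  anticodes of total rank \<open>p\<close>.\<close>

definition filled_space :: "nat \<Rightarrow> (nat \<Rightarrow> 'a mat) set" where
  "filled_space p = Pi\<^sub>E {1..t} (\<lambda>i. column_anticode (m i) (n i) (filled p i))"

lemma filled_space:
  assumes "p \<le> ncols t"
  shows "code (filled_space p)" "dimension (filled_space p) = (\<Sum>p'=1..p. mu p')"
    and "\<And>C. C \<subseteq> filled_space p \<Longrightarrow> weight C \<le> p"
proof -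
  let ?A = "\<lambda>i. column_anticode (m i) (n i) (filled p i) :: 'a mat set"
  have oac: "optimal_anticode (m i) (n i) (?A i)" "maxrank (m i) (?A i) = filled p i" if "i \<in> {1..t}" for i
    using optimal_anticode_column_anticode[of "m i" "n i" "filled p i", where 'a='a]
      n_bounds[OF that] filled_le[OF that assms] by auto
  then have A: "anticodes ?A" by (simp add: anticodes_def)
  show "code (filled_space p)" unfolding filled_space_def by (rule code_anticodes[OF A])
  show "dimension (filled_space p) = (\<Sum>p'=1..p. mu p')"
    unfolding filled_space_def dimension_anticodes[OF A] using oac(2) sum_filled(2)[OF assms] by simp
  have "total_rank ?A = p" unfolding total_rank_def using oac(2) sum_filled(1)[OF assms] by simp
  then show "weight C \<le> p" if "C \<subseteq> filled_space p" for C
    using weight_le[OF A] that by (simp add: filled_space_def)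
qed

lemma filled_space_mono: "p \<le> p' \<Longrightarrow> filled_space p \<subseteq> filled_space p'"
  unfolding filled_space_def column_anticode_def
  by (intro PiE_mono) (auto dest: filled_mono intro: le_trans)

lemma sum_mu_blocks:
  assumes "a \<le> b" "b \<le> t"
  shows "(\<Sum>p\<in>{ncols a<..ncols b}. mu p) = (\<Sum>i\<in>{a<..b}. m i * n i)"
  using assms
proof (induction b rule: dec_induct)
  case base
  then show ?case by simp
next
  case (step b)
  have "{ncols a<..ncols (Suc b)} = {ncols a<..ncols b} \<union> {ncols b<..ncols (Suc b)}"
    using ncols_mono[OF step(1)] ncols_mono[of b "Suc b"] by auto
  moreover have "(\<Sum>p\<in>{ncols b<..ncols (Suc b)}. mu p) = (\<Sum>p\<in>{ncols b<..ncols (Suc b)}. m (Suc b))"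
    by (intro sum.cong refl) (auto simp: mu_def block_eqI[of "Suc b"])
  moreover have "{a<..Suc b} = insert (Suc b) {a<..b}" using step(1) by auto
  ultimately show ?case using step by (simp add: sum.union_disjoint ncols_Suc)
qed

lemma dimension_M: "dimension (carrier M) = (\<Sum>p=1..ncols t. mu p)"
proof -
  have fn: "filled (ncols t) i = n i" if i: "i \<in> {1..t}" for i
  proof (rule ccontr)
    assume "filled (ncols t) i \<noteq> n i"
    then have "filled (ncols t) i < n i" using filled_le[OF i order_refl] by simp
    then have "(\<Sum>i=1..t. filled (ncols t) i) < (\<Sum>i=1..t. n i)"
      using filled_le[OF _ order_refl] i by (intro sum_strict_mono_ex1) auto
    then show False using sum_filled(1)[OF order_refl] by (simp add: ncols_def)
  qed
  have "filled_space (ncols t) = carrier M"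
    unfolding filled_space_def sr_space_simps using fn by (intro PiE_cong) (auto simp: column_anticode_def)
  then show ?thesis using filled_space(2)[OF order_refl] by simp
qed

text \<open>The pair \<open>j\<close>, \<delta> encodes a single column number: \<open>h\<close> is
  column \<delta> + 1 of block \<open>j\<close>. The subtracted term is the height of the \<delta>
  columns of block \<open>j\<close> that precede it, so the dimension is the total height of the
  columns from \<open>h\<close> on.\<close>

lemma MSRD_dimension:
  fixes C :: "(nat \<Rightarrow> 'a mat) set"
  assumes C: "MSRD t m n C" "min_dist t m n C = h"
  shows "1 \<le> h" "h \<le> ncols t" "dimension C = (\<Sum>p=h..ncols t. mu p)" "code C"
proof -
  obtain j \<delta> where j: "j \<in> {1..t}" "\<delta> < n j" "h = (\<Sum>i=1..<j. n i) + \<delta> + 1"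
    "dimension C = (\<Sum>i=j..t. m i * n i) - \<delta> * m j" and code: "code C"
    using C(1) unfolding MSRD_def C(2) by blast
  show "code C" by fact
  have "{1..<j} = {1..j - 1}" using j(1) by auto
  then have h: "h = ncols (j - 1) + \<delta> + 1" using j(3) by (simp add: ncols_def)
  have cj: "ncols j = ncols (j - 1) + n j" using ncols_Suc[of "j - 1"] j(1) by simp
  show "1 \<le> h" using h by simp
  show ht: "h \<le> ncols t" using h j cj ncols_mono[of j t] by simp
  have "{j - 1<..t} = {j..t}" "j - 1 \<le> t" using j(1) by auto
  then have "(\<Sum>i=j..t. m i * n i) = (\<Sum>p\<in>{ncols (j - 1)<..ncols t}. mu p)"
    using sum_mu_blocks[of "j - 1" t] by simp
  also have "{ncols (j - 1)<..ncols t} = {ncols (j - 1)<..ncols (j - 1) + \<delta>} \<union> {h..ncols t}"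
    using ht h by auto
  also have "(\<Sum>p\<in>\<dots>. mu p) = (\<Sum>p\<in>{ncols (j - 1)<..ncols (j - 1) + \<delta>}. mu p) + (\<Sum>p=h..ncols t. mu p)"
    using h by (intro sum.union_disjoint) auto
  also have "(\<Sum>p\<in>{ncols (j - 1)<..ncols (j - 1) + \<delta>}. mu p) = (\<Sum>p\<in>{ncols (j - 1)<..ncols (j - 1) + \<delta>}. m j)"
    using j cj by (intro sum.cong refl) (auto simp: mu_def block_eqI[of j])
  finally show "dimension C = (\<Sum>p=h..ncols t. mu p)" using j(4) by simp
qed

text \<open>Let \<open>b\<close> be the block of column \<open>Suc p\<close>. The blocks before
  \<open>b\<close> have fewer than \<open>Suc p\<close> columns, so they cannot carry the whole rank
  of an enclosing product of anticodes. Some block \<open>l \<ge> b\<close> therefore has positive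
  maximal rank. Lowering it by one costs \<open>m l\<close> dimensions, and
  \<open>m l \<le> m b = mu (Suc p)\<close> because heights do not increase.\<close>

lemma ex_subcode_smaller_weight:
  assumes U: "code U" and wt: "weight U = Suc p"
  obtains U' where "code U'" "U' \<subseteq> U" "weight U' \<le> p" "dimension U \<le> dimension U' + mu (Suc p)"
proof -
  obtain A where A: "anticodes A" "U \<subseteq> Pi\<^sub>E {1..t} A" "weight U = total_rank A"
    using weight_attained[OF code_subset[OF U]] .
  define u where "u i = maxrank (m i) (A i)" for i
  have u_sum: "(\<Sum>i=1..t. u i) = Suc p" using A(3) wt by (simp add: total_rank_def u_def)
  have pt: "Suc p \<le> ncols t" using weight_le_n[OF code_subset[OF U]] wt by (simp add: ncols_def)
  define b where "b = block (Suc p)"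
  have b: "b \<in> {1..t}" "ncols (b - 1) < Suc p" using block[of "Suc p"] pt by (auto simp: b_def)
  have "\<exists>l\<in>{b..t}. u l > 0"
  proof (rule ccontr)
    assume "\<not> ?thesis"
    then have "(\<Sum>i=1..t. u i) = (\<Sum>i=1..b - 1. u i)"
      using b(1) by (intro sum.mono_neutral_right) auto
    also have "\<dots> \<le> ncols (b - 1)"
      unfolding ncols_def u_def using total_rank_le(2)[OF A(1)] b(1) by (intro sum_mono) auto
    finally show False using b(2) u_sum by simp
  qed
  then obtain l where l: "b \<le> l" "l \<in> {1..t}" "u l > 0" using b(1) by fastforce
  then obtain v where v: "u l = Suc v" by (cases "u l") auto
  have ml: "m l \<le> mu (Suc p)"
    unfolding mu_def b_def[symmetric] using m_antimono l b(1) by simp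
  obtain A' where A': "A' \<subseteq> A l" "optimal_anticode (m l) (n l) A'" "maxrank (m l) A' = v"
    using ex_sub_optimal_anticode[of "m l" "n l" "A l" v] A(1) l(2) n_bounds[OF l(2)] v
    by (auto simp: anticodes_def u_def)
  let ?B = "A(l := A')"
  have B: "anticodes ?B" using A(1) A'(2) by (simp add: anticodes_def)
  have uB: "maxrank (m i) (?B i) = (u(l := v)) i" for i using A'(3) by (simp add: u_def)
  have rem: "(\<Sum>i=1..t. f i) = f l + (\<Sum>i\<in>{1..t} - {l}. f i)" for f :: "nat \<Rightarrow> nat"
    using l(2) by (simp add: sum.remove)
  have "total_rank ?B = p"
    using u_sum v unfolding total_rank_def uB rem by simp
  moreover have "dimension (Pi\<^sub>E {1..t} A) = dimension (Pi\<^sub>E {1..t} ?B) + m l"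
    unfolding dimension_anticodes[OF A(1)] dimension_anticodes[OF B] uB u_def[symmetric] rem
    by (simp add: v)
  moreover have "Pi\<^sub>E {1..t} ?B \<subseteq> Pi\<^sub>E {1..t} A" using A'(1) by (intro PiE_mono) auto
  ultimately show thesis
    using dimension_Int[OF U code_anticodes[OF B] code_anticodes[OF A(1)] A(2)]
      weight_le[OF B, of "U \<inter> Pi\<^sub>E {1..t} ?B"] subspace_Int[OF U code_anticodes[OF B]] ml
    by (intro that[of "U \<inter> Pi\<^sub>E {1..t} ?B"]) auto
qed

subsection \<open>Generalized weights\<close>

abbreviation gweight :: "(nat \<Rightarrow> 'a mat) set \<Rightarrow> nat \<Rightarrow> nat" where "gweight \<equiv> gen_wt t m n"

lemma finite_gweight_set:
  assumes "code C"
  shows "finite {weight U | U. code U \<and> U \<subseteq> C \<and> dimension U \<ge> r}"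
proof (rule finite_subset)
  show "{weight U | U. code U \<and> U \<subseteq> C \<and> dimension U \<ge> r} \<subseteq> weight ` Pow C" by auto
qed (use finite_code[OF assms] in simp)

lemma gweight_le:
  assumes "code C" "code U" "U \<subseteq> C" "r \<le> dimension U"
  shows "gweight C r \<le> weight U"
  unfolding gen_wt_def using assms by (intro Min_le finite_gweight_set) auto

lemma gweight_attained:
  assumes "code C" "r \<le> dimension C"
  obtains U where "code U" "U \<subseteq> C" "r \<le> dimension U" "weight U = gweight C r"
proof -
  have "{weight U | U. code U \<and> U \<subseteq> C \<and> dimension U \<ge> r} \<noteq> {}" using assms by blast
  from Min_in[OF finite_gweight_set[OF assms(1)] this]
  obtain U where "gweight C r = weight U" "code U" "U \<subseteq> C" "r \<le> dimension U"
    unfolding gen_wt_def[symmetric] by blast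
  then show thesis using that[of U] by simp
qed

lemma gweight_mono:
  assumes "code C" "r \<le> s" "s \<le> dimension C"
  shows "gweight C r \<le> gweight C s"
proof -
  obtain U where "code U" "U \<subseteq> C" "s \<le> dimension U" "weight U = gweight C s"
    using gweight_attained[OF assms(1,3)] .
  then show ?thesis using gweight_le[OF assms(1), of U r] assms(2) by simp
qed

lemma gweight_le_n: "code C \<Longrightarrow> r \<le> dimension C \<Longrightarrow> gweight C r \<le> ncols t"
  using gweight_attained weight_le_n code_subset by (metis ncols_def)

lemma nonzero_if_dimension_pos:
  assumes "code U" "1 \<le> dimension U"
  obtains X where "X \<in> U" "X \<noteq> \<zero>\<^bsub>M\<^esub>"
proof -
  have "\<not> U \<subseteq> {\<zero>\<^bsub>M\<^esub>}"
  proof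
    assume "U \<subseteq> {\<zero>\<^bsub>M\<^esub>}"
    then have "card U \<le> 1" using card_mono[of "{\<zero>\<^bsub>M\<^esub>}" U] by simp
    moreover have "1 < CARD('a) ^ dimension U" using q_gt_1 assms(2) by (intro one_less_power) auto
    ultimately show False using card_code[OF assms(1)] by simp
  qed
  then show thesis using that by auto
qed

lemma min_dist_le_srk:
  assumes "code D" "X \<in> D" "X \<noteq> \<zero>\<^bsub>M\<^esub>"
  shows "min_dist t m n D \<le> srk t m X"
  unfolding min_dist_def using finite_code[OF assms(1)] assms(2,3) by (intro Min_le) auto

lemma min_dist_le_weight:
  assumes "code D" "code U" "1 \<le> dimension (U \<inter> D)"
  shows "min_dist t m n D \<le> weight U"
proof -
  obtain X where "X \<in> U \<inter> D" "X \<noteq> \<zero>\<^bsub>M\<^esub>"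
    using nonzero_if_dimension_pos[OF subspace_Int[OF assms(2,1)] assms(3)] .
  then show ?thesis
    using min_dist_le_srk[OF assms(1), of X] srk_le_weight[OF code_subset[OF assms(2)], of X] by simp
qed

lemma card_gweight_eq_le:
  assumes C: "code C"
  shows "card {r \<in> {1..dimension C}. gweight C r = Suc p} \<le> mu (Suc p)"
proof (cases "{r \<in> {1..dimension C}. gweight C r = Suc p} = {}")
  case True
  then show ?thesis by (simp only: card.empty)
next
  case False
  let ?R = "{r \<in> {1..dimension C}. gweight C r = Suc p}"
  \<comment> \<open>A subcode for the last index \<open>s\<close> with this weight contains one of
    smaller weight and dimension at least \<open>s - mu (Suc p)\<close>, which pushes all weights up
    to that index below \<open>Suc p\<close>.\<close>
  define s where "s = Max ?R"
  have "s \<in> ?R" unfolding s_def using False by (intro Max_in) auto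
  then obtain U where U: "code U" "U \<subseteq> C" "s \<le> dimension U" "weight U = Suc p"
    using gweight_attained[OF C, of s] by auto
  obtain U' where U': "code U'" "U' \<subseteq> U" "weight U' \<le> p" "dimension U \<le> dimension U' + mu (Suc p)"
    using ex_subcode_smaller_weight[OF U(1,4)] .
  have "?R \<subseteq> {s - mu (Suc p)<..s}"
  proof
    fix r assume r: "r \<in> ?R"
    have "r \<le> s" unfolding s_def using r by (intro Max_ge) auto
    moreover have "s - mu (Suc p) < r"
    proof (rule ccontr)
      assume "\<not> ?thesis"
      then have "gweight C r \<le> weight U'"
        using gweight_le[OF C U'(1)] U U' by auto
      then show False using r U'(3) by simp
    qed
    ultimately show "r \<in> {s - mu (Suc p)<..s}" by simp
  qed
  from card_mono[OF _ this] show ?thesis by simp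
qed

section \<open>Multiplicities in the sequence of generalized weights\<close>

lemma length_gen_wts: "length (gen_wts t m n C) = dimension C"
  by (simp add: gen_wts_def)

lemma nth_gen_wts: "i < dimension C \<Longrightarrow> gen_wts t m n C ! i = gweight C (Suc i)"
  by (simp add: gen_wts_def del: upt_Suc)

lemma set_gen_wts: "set (gen_wts t m n C) = gweight C ` {1..dimension C}"
  by (auto simp: gen_wts_def)

lemma sorted_gen_wts: "code C \<Longrightarrow> sorted (gen_wts t m n C)"
  using gweight_mono by (auto simp: sorted_iff_nth_mono length_gen_wts nth_gen_wts)

lemma count_gen_wts: "count_list (gen_wts t m n C) p = card {r \<in> {1..dimension C}. gweight C r = p}"
proof -
  have "count_list (gen_wts t m n C) p = length (filter (\<lambda>r. gweight C r = p) [1..<dimension C + 1])"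
    by (simp add: gen_wts_def count_list_eq_length_filter filter_map o_def eq_commute)
  also have "\<dots> = card (set (filter (\<lambda>r. gweight C r = p) [1..<dimension C + 1]))"
    by (intro distinct_card[symmetric] distinct_filter distinct_upt)
  also have "set (filter (\<lambda>r. gweight C r = p) [1..<dimension C + 1])
      = {r \<in> {1..dimension C}. gweight C r = p}" by auto
  finally show ?thesis .
qed

lemma count_gen_wts_le:
  assumes "code C" "1 \<le> p"
  shows "count_list (gen_wts t m n C) p \<le> mu p"
  using card_gweight_eq_le[OF assms(1), of "p - 1"] assms(2) by (simp add: count_gen_wts)

lemma set_gen_wts_subset:
  assumes "code C" "code D" "C \<subseteq> D"
  shows "set (gen_wts t m n C) \<subseteq> {min_dist t m n D..ncols t}"
proof
  fix x assume "x \<in> set (gen_wts t m n C)"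
  then obtain r where r: "1 \<le> r" "r \<le> dimension C" "x = gweight C r" by (auto simp: set_gen_wts)
  obtain U where U: "code U" "U \<subseteq> C" "r \<le> dimension U" "weight U = gweight C r"
    using gweight_attained[OF assms(1) r(2)] .
  have "U \<inter> D = U" using U(2) assms(3) by auto
  then have "min_dist t m n D \<le> weight U"
    using min_dist_le_weight[OF assms(2) U(1)] U(3) r(1) by simp
  then show "x \<in> {min_dist t m n D..ncols t}"
    using gweight_le_n[OF assms(1) r(2)] U(4) r(3) by simp
qed

lemma count_gen_wts_MSRD:
  fixes D :: "(nat \<Rightarrow> 'a mat) set"
  assumes D: "MSRD t m n D" "min_dist t m n D = d" and p: "p \<in> {d..ncols t}"
  shows "count_list (gen_wts t m n D) p = mu p"
proof -
  note MD = MSRD_dimension[OF D]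
  have "(\<Sum>p=d..ncols t. count_list (gen_wts t m n D) p) = (\<Sum>p=d..ncols t. mu p)"
    using sum_count_set[OF set_gen_wts_subset[OF MD(4,4) order_refl]] D(2) MD(3)
    by (simp add: length_gen_wts)
  moreover have "count_list (gen_wts t m n D) i \<le> mu i" if "i \<in> {d..ncols t}" for i
    using count_gen_wts_le[OF MD(4), of i] MD(1) that by auto
  \<comment> \<open>Termwise inequalities between equal sums are equalities.\<close>
  ultimately show ?thesis by (rule sum_mono_inv[OF _ _ p]) simp_all
qed

lemma subseq_gen_wts_MSRD:
  assumes D: "MSRD t m n D" and C: "code C" "C \<subseteq> D"
  shows "subseq (gen_wts t m n C) (gen_wts t m n D)"
proof (rule subseq_if_sorted_count_le)
  note MD = MSRD_dimension[OF D refl]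
  show "sorted (gen_wts t m n C)" "sorted (gen_wts t m n D)"
    using sorted_gen_wts C MD(4) by auto
  show "count_list (gen_wts t m n C) p \<le> count_list (gen_wts t m n D) p" for p
  proof (cases "p \<in> {min_dist t m n D..ncols t}")
    case True
    then show ?thesis
      using count_gen_wts_le[OF C(1), of p] MD(1) count_gen_wts_MSRD[OF D refl True] by simp
  next
    case False
    then have "p \<notin> set (gen_wts t m n C)" using set_gen_wts_subset[OF C(1) MD(4) C(2)] by blast
    then show ?thesis by (simp add: count_list_0_iff)
  qed
qed

end

section \<open>Construction of subcodes with prescribed weights\<close>

locale MSRD_chain = sum_rank_space ty t m n
  for ty :: "'a::{field,finite} itself" and t m n +
  fixes d :: nat and Dc :: "nat \<Rightarrow> (nat \<Rightarrow> 'a mat) set"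
  assumes Dc: "\<And>h. h \<in> {d..ncols t} \<Longrightarrow> MSRD t m n (Dc h) \<and> min_dist t m n (Dc h) = h"
    and Dc_Suc: "\<And>h. h \<in> {d..<ncols t} \<Longrightarrow> Dc (Suc h) \<subseteq> Dc h"
    and d_le: "d \<le> ncols t" and d_pos: "1 \<le> d"
begin

lemma Dc_props:
  assumes "h \<in> {d..ncols t}"
  shows "code (Dc h)" "min_dist t m n (Dc h) = h" "dimension (Dc h) = (\<Sum>p=h..ncols t. mu p)"
  using Dc[OF assms] MSRD_dimension by auto

lemma Dc_antimono:
  assumes "d \<le> h" "h \<le> h'" "h' \<le> ncols t"
  shows "Dc h' \<subseteq> Dc h"
  using assms(2,3)
proof (induction h' rule: dec_induct)
  case (step h')
  then show ?case using Dc_Suc[of h'] assms(1) by auto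
qed simp

text \<open>Nonzero members of \<open>Dc p\<close> have sum-rank at least \<open>p\<close>, more
  than \<open>p - 1\<close> columns allow.\<close>

lemma inter_trivial:
  assumes "p \<in> {d..ncols t}"
  shows "Dc p \<inter> filled_space (p - 1) = {\<zero>\<^bsub>M\<^esub>}"
proof -
  have f: "p - 1 \<le> ncols t" using assms by auto
  note F = filled_space(1,3)[OF f]
  have "\<zero>\<^bsub>M\<^esub> \<in> Dc p \<inter> filled_space (p - 1)" using Dc_props(1)[OF assms] F(1) zero_in_code by auto
  moreover have "X = \<zero>\<^bsub>M\<^esub>" if X: "X \<in> Dc p" "X \<in> filled_space (p - 1)" for X
  proof (rule ccontr)
    assume "X \<noteq> \<zero>\<^bsub>M\<^esub>"
    then have "p \<le> srk t m X" using min_dist_le_srk[OF Dc_props(1)[OF assms] X(1)] Dc_props(2)[OF assms] by simp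
    also have "\<dots> \<le> weight (filled_space (p - 1))" using srk_le_weight[OF code_subset[OF F(1)] X(2)] .
    also have "\<dots> \<le> p - 1" using F(2)[OF order_refl] .
    finally show False using d_pos assms by auto
  qed
  ultimately show ?thesis by blast
qed

definition slice :: "nat \<Rightarrow> (nat \<Rightarrow> 'a mat) set" where
  "slice p = Dc p \<inter> filled_space p"

text \<open>\<open>Dc p\<close> has the heights of the columns from \<open>p\<close> on as its
  dimension, \<open>filled_space p\<close> those up to \<open>p\<close>. Column \<open>p\<close> is
  counted twice, so the two dimensions exceed that of the whole space by
  \<open>mu p\<close>.\<close>

lemma slice:
  assumes "p \<in> {d..ncols t}"
  shows "code (slice p)" "mu p \<le> dimension (slice p)"
proof -
  have p: "p \<le> ncols t" "1 \<le> p" using assms d_pos by auto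
  show "code (slice p)"
    unfolding slice_def using Dc_props(1)[OF assms] filled_space(1)[OF p(1)] by (rule subspace_Int)
  have "{1..ncols t} = {1..p} \<union> {Suc p..ncols t}" "{p..ncols t} = insert p {Suc p..ncols t}" using p by auto
  then have "(\<Sum>p'=1..ncols t. mu p') + mu p = (\<Sum>p'=1..p. mu p') + (\<Sum>p'=p..ncols t. mu p')"
    by (simp add: sum.union_disjoint)
  then show "mu p \<le> dimension (slice p)"
    using dimension_Int[OF Dc_props(1)[OF assms] filled_space(1)[OF p(1)] code_M
        code_subset[OF Dc_props(1)[OF assms]] code_subset[OF filled_space(1)[OF p(1)]]]
    by (simp add: dimension_M Dc_props(3)[OF assms] filled_space(2)[OF p(1)] slice_def)
qed

text \<open>The prefixes of \<open>ds\<close> are realised one after the other by subcodes whose intersections with the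
  \<open>filled_space p\<close> bound the generalized weights from above, and with the \<open>Dc p\<close> from below.\<close>

definition realises :: "nat list \<Rightarrow> nat \<Rightarrow> (nat \<Rightarrow> 'a mat) set \<Rightarrow> bool" where
  "realises ds r W \<longleftrightarrow> code W \<and> W \<subseteq> Dc d \<and> dimension W = r \<and>
     (\<forall>p\<le>ncols t. card {i. i < r \<and> ds ! i \<le> p} \<le> dimension (W \<inter> filled_space p)) \<and>
     (\<forall>p\<in>{d..ncols t}. card {i. i < r \<and> p \<le> ds ! i} \<le> dimension (W \<inter> Dc p))"

lemma realises_0: "realises ds 0 {\<zero>\<^bsub>M\<^esub>}"
proof -
  have c: "code {\<zero>\<^bsub>M\<^esub>}"
    unfolding code_iff by (auto simp: sr_space_simps intro!: restrict_ext)
  have "d \<in> {d..ncols t}" using d_le by auto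
  then have "{\<zero>\<^bsub>M\<^esub>} \<subseteq> Dc d" using zero_in_code[OF Dc_props(1)] by auto
  moreover have "dimension {\<zero>\<^bsub>M\<^esub>} = 0" using dimension_eqI[OF c, of 0] by simp
  ultimately show ?thesis using c by (simp add: realises_def)
qed

text \<open>The new vector comes from \<open>slice p\<close> with \<open>p = ds ! r\<close>. If
  \<open>W\<close> contained \<open>slice p\<close>, it would contain this space and
  \<open>W \<inter> filled_space (p - 1)\<close>, which meet only in zero; then \<open>r\<close>
  would be at least \<open>mu p\<close> plus the number of earlier entries below \<open>p\<close>.
  As \<open>ds\<close> is sorted, \<open>mu p\<close> or more of its first \<open>r\<close> entries
  would equal \<open>p\<close>, and entry \<open>r\<close> would be one too many.\<close>

lemma realises_Suc:
  assumes W: "realises ds r W" and r: "r < length ds" and ds: "sorted ds" "ds ! r \<in> {d..ncols t}"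
    and count: "count_list ds (ds ! r) \<le> mu (ds ! r)"
  obtains W' where "realises ds (Suc r) W'" "W \<subseteq> W'"
proof -
  define p where "p = ds ! r"
  have p: "p \<in> {d..ncols t}" using ds(2) by (simp add: p_def)
  have pt: "p \<le> ncols t" "p - 1 \<le> ncols t" using p by auto
  have Wc: "code W" "W \<subseteq> Dc d" "dimension W = r"
    and WF: "\<And>p. p \<le> ncols t \<Longrightarrow> card {i. i < r \<and> ds ! i \<le> p} \<le> dimension (W \<inter> filled_space p)"
    and WD: "\<And>p. p \<in> {d..ncols t} \<Longrightarrow> card {i. i < r \<and> p \<le> ds ! i} \<le> dimension (W \<inter> Dc p)"
    using W by (auto simp: realises_def)
  have "\<not> slice p \<subseteq> W"
  proof
    assume sub: "slice p \<subseteq> W"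
    note F = filled_space(1)[OF pt(2)]
    have "slice p \<inter> (W \<inter> filled_space (p - 1)) \<subseteq> {\<zero>\<^bsub>M\<^esub>}" using inter_trivial[OF p] by (auto simp: slice_def)
    then have z: "slice p \<inter> (W \<inter> filled_space (p - 1)) = {\<zero>\<^bsub>M\<^esub>}"
      using zero_in_code slice(1)[OF p] Wc(1) F by auto
    have "dimension {\<zero>\<^bsub>M\<^esub>} = 0" using realises_0 by (auto simp: realises_def)
    then have le: "mu p + card {i. i < r \<and> ds ! i \<le> p - 1} \<le> r"
      using dimension_Int[OF slice(1)[OF p] subspace_Int[OF Wc(1) F] Wc(1) sub] slice(2)[OF p]
        WF[OF pt(2)] Wc(3) z by simp
    have "{..<r} \<subseteq> {i. i < r \<and> ds ! i \<le> p - 1} \<union> {i. i < r \<and> ds ! i = p}"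
    proof
      fix i assume "i \<in> {..<r}"
      then have "i < r" "ds ! i \<le> p" using sorted_nth_mono[OF ds(1), of i r] r by (auto simp: p_def)
      then show "i \<in> {i. i < r \<and> ds ! i \<le> p - 1} \<union> {i. i < r \<and> ds ! i = p}" by auto
    qed
    from card_mono[OF _ this] have "r \<le> card {i. i < r \<and> ds ! i \<le> p - 1} + card {i. i < r \<and> ds ! i = p}"
      using card_Un_le[of "{i. i < r \<and> ds ! i \<le> p - 1}" "{i. i < r \<and> ds ! i = p}"] by simp
    moreover have "insert r {i. i < r \<and> ds ! i = p} \<subseteq> {i. i < length ds \<and> ds ! i = p}"
      using r by (auto simp: p_def)
    from card_mono[OF _ this] have "Suc (card {i. i < r \<and> ds ! i = p}) \<le> count_list ds p"
      by (simp add: count_list_eq_length_filter length_filter_conv_card eq_commute)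
    ultimately show False using le count by (simp add: p_def)
  qed
  then obtain x where x: "x \<in> Dc p" "x \<in> filled_space p" "x \<notin> W" by (auto simp: slice_def)
  have xM: "x \<in> carrier M" using x(1) code_subset[OF Dc_props(1)[OF p]] by auto
  obtain W' where W': "code W'" "W \<subseteq> W'" "card W' = CARD('a) * card W"
    and inter: "\<And>D. code D \<Longrightarrow> finite (W' \<inter> D) \<Longrightarrow> x \<in> D \<Longrightarrow> CARD('a) * card (W \<inter> D) \<le> card (W' \<inter> D)"
    and min: "\<And>D. code D \<Longrightarrow> W \<subseteq> D \<Longrightarrow> x \<in> D \<Longrightarrow> W' \<subseteq> D"
    using ex_adjoin[OF Wc(1) xM x(3)] by blast
  \<comment> \<open>The vector lies in \<open>filled_space p'\<close> for \<open>p \<le> p'\<close>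
    and in \<open>Dc p'\<close> for \<open>d \<le> p' \<le> p\<close>, which is where the counts
    required by \<open>realises\<close> go up by one.\<close>
  have dim_Int: "Suc (dimension (W \<inter> D)) \<le> dimension (W' \<inter> D)" if D: "code D" "x \<in> D" for D
    using inter[OF D(1) _ D(2)] finite_code[OF W'(1)] card_code[OF subspace_Int[OF Wc(1) D(1)]]
    by (intro le_dimensionI subspace_Int W'(1) D(1)) auto
  have mono: "dimension (W \<inter> D) \<le> dimension (W' \<inter> D)" if "code D" for D
    using W'(1,2) Wc(1) that by (intro dimension_mono subspace_Int) auto
  have card_Suc: "card {i. i < Suc r \<and> P (ds ! i)} =
      card {i. i < r \<and> P (ds ! i)} + (if P p then 1 else 0)" for P
  proof -
    have "{i. i < Suc r \<and> P (ds ! i)}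
        = (if P p then insert r {i. i < r \<and> P (ds ! i)} else {i. i < r \<and> P (ds ! i)})"
      by (auto simp: p_def less_Suc_eq)
    then show ?thesis by simp
  qed
  have "realises ds (Suc r) W'"
    unfolding realises_def
  proof (intro conjI ballI allI impI)
    show "code W'" by fact
    have d: "d \<in> {d..ncols t}" using d_le by auto
    show "W' \<subseteq> Dc d" using Wc(2) x(1) Dc_antimono[of d p] p by (intro min Dc_props(1)[OF d]) auto
    show "dimension W' = Suc r" using W'(1,3) card_code[OF Wc(1)] Wc(3) by (intro dimension_eqI) auto
  next
    fix p' assume p': "p' \<le> ncols t"
    note F = filled_space(1)[OF p']
    show "card {i. i < Suc r \<and> ds ! i \<le> p'} \<le> dimension (W' \<inter> filled_space p')"
    proof (cases "p \<le> p'")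
      case True
      then have "x \<in> filled_space p'" using x(2) filled_space_mono by blast
      from dim_Int[OF F this] show ?thesis using True WF[OF p'] card_Suc[of "\<lambda>x. x \<le> p'"] by simp
    next
      case False
      then show ?thesis using mono[OF F] WF[OF p'] card_Suc[of "\<lambda>x. x \<le> p'"] by simp
    qed
  next
    fix p' assume p': "p' \<in> {d..ncols t}"
    note F = Dc_props(1)[OF p']
    show "card {i. i < Suc r \<and> p' \<le> ds ! i} \<le> dimension (W' \<inter> Dc p')"
    proof (cases "p' \<le> p")
      case True
      then have "x \<in> Dc p'" using x(1) Dc_antimono[of p' p] p p' by auto
      from dim_Int[OF F this] show ?thesis using True WD[OF p'] card_Suc[of "\<lambda>x. p' \<le> x"] by simp
    next
      case False
      then show ?thesis using mono[OF F] WD[OF p'] card_Suc[of "\<lambda>x. p' \<le> x"] by simp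
    qed
  qed
  then show thesis using that W'(2) by blast
qed

lemma ex_subcode_chain:
  assumes "subseq ds (gen_wts t m n (Dc d))"
  obtains U where "\<And>r. r \<le> length ds \<Longrightarrow> realises ds r (U r)" "\<And>r. r < length ds \<Longrightarrow> U r \<subseteq> U (Suc r)"
proof -
  have d: "d \<in> {d..ncols t}" using d_le by auto
  note D = Dc_props(1)[OF d] and MD = Dc[OF d]
  have sorted: "sorted ds" using sorted_if_subseq[OF assms sorted_gen_wts[OF D]] .
  have "set ds \<subseteq> set (gen_wts t m n (Dc d))" using assms by (auto elim: list_emb_set)
  then have range: "ds ! r \<in> {d..ncols t}" if "r < length ds" for r
  proof -
    have "ds ! r \<in> set (gen_wts t m n (Dc d))" using \<open>set ds \<subseteq> _\<close> nth_mem[OF that] by blast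
    then show ?thesis using set_gen_wts_subset[OF D D order_refl] MD by auto
  qed
  have count: "count_list ds (ds ! r) \<le> mu (ds ! r)" if "r < length ds" for r
    using count_list_le_if_subseq[OF assms, of "ds ! r"] count_gen_wts_MSRD[of "Dc d" d, OF _ _ range[OF that]] MD
    by simp
  have "\<exists>U. \<forall>r. (r \<le> length ds \<longrightarrow> realises ds r (U r)) \<and> (r < length ds \<longrightarrow> U r \<subseteq> U (Suc r))"
  proof (rule dependent_nat_choice)
    show "\<exists>W. 0 \<le> length ds \<longrightarrow> realises ds 0 W" using realises_0 by blast
    show "\<exists>W'. (Suc r \<le> length ds \<longrightarrow> realises ds (Suc r) W') \<and> (r < length ds \<longrightarrow> W \<subseteq> W')"
      if W: "r \<le> length ds \<longrightarrow> realises ds r W" for W r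
    proof (cases "r < length ds")
      case True
      then have "realises ds r W" using W by simp
      then obtain W' where "realises ds (Suc r) W'" "W \<subseteq> W'"
        using realises_Suc[OF _ True sorted range[OF True] count[OF True]] by blast
      then show ?thesis by blast
    qed auto
  qed
  then show thesis using that by blast
qed

lemma realised_weights:
  assumes ds: "sorted ds" "set ds \<subseteq> {d..ncols t}"
    and C: "realises ds (length ds) C" and r: "r \<in> {1..length ds}"
    and U: "realises ds r U" "U \<subseteq> C"
  shows "weight U = gweight C r" "gweight C r = ds ! (r - 1)"
proof -
  define p where "p = ds ! (r - 1)"
  have "p \<in> set ds" using r by (auto simp: p_def)
  then have p: "p \<in> {d..ncols t}" using ds(2) by blast
  then have pt: "p \<le> ncols t" by simp
  have Cc: "code C" "dimension C = length ds" and Uc: "code U" "dimension U = r"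
    using C U by (auto simp: realises_def)
  \<comment> \<open>The first \<open>r\<close> entries are at most \<open>p\<close>, so the count
    forces all of \<open>U\<close> into \<open>filled_space p\<close>.\<close>
  have "{i. i < r \<and> ds ! i \<le> p} = {..<r}"
    using sorted_nth_mono[OF ds(1), of _ "r - 1"] r by (auto simp: p_def)
  then have "r \<le> dimension (U \<inter> filled_space p)" using U(1) pt by (auto simp: realises_def)
  then have "CARD('a) ^ r \<le> card (U \<inter> filled_space p)"
    using card_code[OF subspace_Int[OF Uc(1) filled_space(1)[OF pt]]] q_gt_1 by simp
  then have "U \<inter> filled_space p = U"
    using card_code[OF Uc(1)] Uc(2) finite_code[OF Uc(1)] by (intro card_seteq) auto
  then have upper: "weight U \<le> p" using filled_space(3)[OF pt] by blast
  have le: "gweight C r \<le> weight U" using gweight_le[OF Cc(1) Uc(1) U(2)] Uc(2) by simp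
  have "p \<le> gweight C r"
  proof -
    obtain U' where U': "code U'" "U' \<subseteq> C" "r \<le> dimension U'" "weight U' = gweight C r"
      using gweight_attained[OF Cc(1), of r] Cc(2) r by auto
    note D = Dc_props[OF p]
    \<comment> \<open>Positions start at \<open>0\<close>, so \<open>ds ! (r - 1)\<close> is the
      \<open>r\<close>-th entry. The entries from there on number \<open>length ds - r + 1\<close>,
      one more than the codimension that a subcode of dimension \<open>r\<close> has in
      \<open>C\<close>; the intersection is nonzero.\<close>
    have "{r - 1..<length ds} \<subseteq> {i. i < length ds \<and> p \<le> ds ! i}"
      using sorted_nth_mono[OF ds(1), of "r - 1"] by (auto simp: p_def)
    from card_mono[OF _ this] have "length ds - (r - 1) \<le> card {i. i < length ds \<and> p \<le> ds ! i}" by simp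
    also have "\<dots> \<le> dimension (C \<inter> Dc p)" using C p unfolding realises_def by blast
    finally have "length ds - (r - 1) \<le> dimension (C \<inter> Dc p)" .
    then have "1 \<le> dimension (U' \<inter> (C \<inter> Dc p))"
      using dimension_Int[OF U'(1) subspace_Int[OF Cc(1) D(1)] Cc(1) U'(2)] U'(3) Cc(2) r by simp
    moreover have "U' \<inter> (C \<inter> Dc p) = U' \<inter> Dc p" using U'(2) by auto
    ultimately show ?thesis using min_dist_le_weight[OF D(1) U'(1)] D(2) U'(4) by simp
  qed
  then show "weight U = gweight C r" "gweight C r = ds ! (r - 1)" using upper le by (auto simp: p_def)
qed

text \<open>The generalized weight bounds the weight of every subcode of dimension \<open>r\<close>
  from below, and the chain attains it at each step, so its members are greedy. Conversely, any
  greedy subcode competes with the member of the chain, which contains the preceding greedy one. Its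
  weight is therefore the generalized weight, and the \<open>THE\<close> in \<open>greedy_wt\<close>
  has a unique value.\<close>

lemma greedy_wts_eq_gen_wts:
  assumes C: "code C" and U: "\<And>r. r \<in> {1..dimension C} \<Longrightarrow> code (U r) \<and> U r \<subseteq> C \<and>
      dimension (U r) = r \<and> weight (U r) = gweight C r"
    and chain: "\<And>r. r \<in> {1..<dimension C} \<Longrightarrow> U r \<subseteq> U (Suc r)"
  shows "greedy_wts t m n C = gen_wts t m n C"
proof -
  have greedy: "greedy_subcode t m n C (Suc r) (U (Suc r))" if "Suc r \<le> dimension C" for r
    using that
  proof (induction r)
    case 0
    then show ?case using U[of 1] by simp
  next
    case (Suc r)
    have "gweight C (Suc (Suc r)) \<le> weight V" if "code V" "V \<subseteq> C" "dimension V = Suc (Suc r)" for V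
      using gweight_le[OF C that(1,2)] that(3) by simp
    then show ?case using Suc U[of "Suc (Suc r)"] chain[of "Suc r"] by auto
  qed
  have eq: "weight W = gweight C (Suc r)" if W: "greedy_subcode t m n C (Suc r) W" and r: "Suc r \<le> dimension C" for r W
  proof (cases r)
    case 0
    then show ?thesis using W by simp
  next
    case (Suc s)
    have "weight W \<le> weight (U (Suc r))"
      using W U[of "Suc r"] chain[of r] greedy[of s] r by (auto simp: Suc)
    moreover have "gweight C (Suc r) \<le> weight W"
      using W by (intro gweight_le[OF C]) (auto simp: Suc)
    ultimately show ?thesis using U[of "Suc r"] r by auto
  qed
  have "greedy_wt t m n C r = gweight C r" if r: "r \<in> {1..dimension C}" for r
  proof -
    obtain s where s: "r = Suc s" using r by (cases r) auto
    show ?thesis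
      unfolding greedy_wt_def
    proof (rule the_equality)
      show "\<exists>V. greedy_subcode t m n C r V \<and> gweight C r = weight V"
        using greedy[of s] U[OF r] r s by (intro exI[of _ "U r"]) auto
      show "w = gweight C r" if "\<exists>V. greedy_subcode t m n C r V \<and> w = weight V" for w
        using eq[of s] that r s by auto
    qed
  qed
  then show ?thesis unfolding greedy_wts_def gen_wts_def by auto
qed

text \<open>The empty list belongs to the zero code, which the chain condition excludes; hence the
  premise \<open>ds \<noteq> []\<close> in the last clause.\<close>

theorem ex_subcode:
  assumes ds: "subseq ds (gen_wts t m n (Dc d))"
  obtains C where "code C" "C \<subseteq> Dc d" "gen_wts t m n C = ds" "greedy_wts t m n C = ds"
    "ds \<noteq> [] \<Longrightarrow> chain_condition t m n C"
proof -
  have d: "d \<in> {d..ncols t}" using d_le by auto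
  note D = Dc_props(1)[OF d] and MD = Dc[OF d]
  let ?k = "length ds"
  obtain U where U: "\<And>r. r \<le> ?k \<Longrightarrow> realises ds r (U r)"
    and chain: "\<And>r. r < ?k \<Longrightarrow> U r \<subseteq> U (Suc r)"
    using ex_subcode_chain[OF ds] by blast
  have Uc: "code (U r)" "U r \<subseteq> Dc d" "dimension (U r) = r" if "r \<le> ?k" for r
    using U[OF that] by (auto simp: realises_def)
  have sub: "U r \<subseteq> U ?k" if "r \<le> ?k" for r
    using that
  proof (induction r rule: inc_induct)
    case (step r)
    then show ?case using chain[of r] by auto
  qed simp
  define C where "C = U ?k"
  have C: "code C" "C \<subseteq> Dc d" "dimension C = ?k" using Uc[of ?k] by (auto simp: C_def)
  have sorted: "sorted ds" using sorted_if_subseq[OF ds sorted_gen_wts[OF D]] .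
  have "set ds \<subseteq> set (gen_wts t m n (Dc d))" using ds by (auto elim: list_emb_set)
  then have range: "set ds \<subseteq> {d..ncols t}"
    using set_gen_wts_subset[OF D D order_refl] MD by auto
  have wts: "weight (U r) = gweight C r" "gweight C r = ds ! (r - 1)" if "r \<in> {1..?k}" for r
    using realised_weights[OF sorted range, of C r "U r"] U sub that by (auto simp: C_def)
  have gen: "gen_wts t m n C = ds"
    using wts(2) C(3) by (intro nth_equalityI) (auto simp: length_gen_wts nth_gen_wts)
  have strict: "U r \<subset> U (Suc r)" if "r < ?k" for r
    using chain[OF that] Uc(3)[of r] Uc(3)[of "Suc r"] that by (metis Suc_leI n_not_Suc_n order_less_imp_le psubsetI)
  show thesis
  proof (rule that[OF C(1,2) gen])
    show "greedy_wts t m n C = ds"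
      unfolding gen[symmetric]
      using Uc wts(1) sub chain C by (intro greedy_wts_eq_gen_wts[of C U]) (auto simp: C_def)
    show "chain_condition t m n C" if "ds \<noteq> []"
    proof -
      have k: "1 \<le> ?k" using that by (cases ds) auto
      have "{\<zero>\<^bsub>M\<^esub>} \<subseteq> U 1" using zero_in_code[OF Uc(1)[OF k]] by simp
      moreover have "U 1 \<noteq> {\<zero>\<^bsub>M\<^esub>}"
        using Uc(3)[OF k] realises_0[of ds] by (auto simp: realises_def)
      ultimately have "{\<zero>\<^bsub>M\<^esub>} \<subset> U 1" by auto
      moreover have "C \<noteq> {\<zero>\<^bsub>M\<^esub>}" using C(3) realises_0[of ds] k by (auto simp: realises_def)
      ultimately show ?thesis
        unfolding chain_condition_def C(3) using C(1) Uc(1) wts(1) strict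
        by (intro conjI exI[of _ U]) (auto simp: C_def)
    qed
  qed
qed

end

theorem theorem4p7:
  fixes t d :: nat and m n :: "nat \<Rightarrow> nat"
    and D :: "(nat \<Rightarrow> 'a :: {field, finite} mat) set"
    and Dc :: "nat \<Rightarrow> (nat \<Rightarrow> 'a mat) set"
  assumes "t \<ge> 1"
    and "\<And>i. i \<in> {1..t} \<Longrightarrow> 1 \<le> n i \<and> n i \<le> m i"
    and "\<And>i j. 1 \<le> i \<Longrightarrow> i \<le> j \<Longrightarrow> j \<le> t \<Longrightarrow> m j \<le> m i"
    and "MSRD t m n D" and "min_dist t m n D = d"
    and "Dc d = D"
    and "\<And>h. h \<in> {d..\<Sum>i=1..t. n i} \<Longrightarrow> MSRD t m n (Dc h) \<and> min_dist t m n (Dc h) = h"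
    and "\<And>h. h \<in> {d..<\<Sum>i=1..t. n i} \<Longrightarrow> Dc (Suc h) \<subseteq> Dc h"
  shows
    "(\<forall>ds :: nat list. (\<forall>x\<in>set ds. 0 < x) \<longrightarrow>
        ((\<exists>C. sr_code t m n C \<and> C \<subseteq> D \<and> gen_wts t m n C = ds) \<longleftrightarrow>
           length ds \<le> code_dim t m n D \<and> subseq ds (gen_wts t m n D))) \<and>
     (\<forall>ds :: nat list. ds \<noteq> [] \<and> (\<forall>x\<in>set ds. 0 < x) \<and>
        length ds \<le> code_dim t m n D \<and> subseq ds (gen_wts t m n D) \<longrightarrow>
        (\<exists>C. sr_code t m n C \<and> C \<subseteq> D \<and> gen_wts t m n C = ds \<and> chain_condition t m n C)) \<and>
     (\<forall>ds :: nat list. ds \<noteq> [] \<and> subseq ds (gen_wts t m n D) \<longrightarrow>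
        (\<exists>C. sr_code t m n C \<and> C \<subseteq> D \<and> greedy_wts t m n C = ds))"
proof -
  interpret sum_rank_space "TYPE('a)" t m n by unfold_locales (use assms(2,3) in auto)
  note MD = MSRD_dimension[OF assms(4,5)]
  interpret MSRD_chain "TYPE('a)" t m n d Dc
    by unfold_locales (use assms(7,8) MD in \<open>auto simp: ncols_def\<close>)
  \<comment> \<open>One and the same subcode serves all three existence claims.\<close>
  have ex: "\<exists>C. code C \<and> C \<subseteq> D \<and> gen_wts t m n C = ds \<and> greedy_wts t m n C = ds \<and>
      (ds \<noteq> [] \<longrightarrow> chain_condition t m n C)"
    if "subseq ds (gen_wts t m n D)" for ds
    using ex_subcode[of ds] that assms(6) by metis
  moreover have "length (gen_wts t m n C) \<le> dimension D \<and> subseq (gen_wts t m n C) (gen_wts t m n D)"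
    if "code C" "C \<subseteq> D" for C
    using subseq_gen_wts_MSRD[OF assms(4) that] dimension_mono[OF that(1) MD(4) that(2)]
    by (simp add: length_gen_wts)
  ultimately show ?thesis by blast
qed

end
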